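(* Let $k$ be a field containing a primitive $n$-th root of unity $q$. Consider the following two connected gradings of the algebra $M_n(k)$. (1) The $C_n\times C_n$-grading $X$, where $C_n=\langle t\rangle$ is cyclic of order $n$, in which the matrix $x$ given on the standard basis by $xe_i=e_{i+1}$ ($1\le i<n$), $xe_n=e_1$ has degree $(t,1)$, and the diagonal matrix $y$ with $ye_i=q^ie_i$ ($1\le i\le n$) has degree $(1,t)$. (2) The $F_{n-1}$-grading $Y$, where $F_{n-1}$ is the free group on $s_1,\dots,s_{n-1}$, in which the elementary matrices ${}_jE_i$ are homogeneous with $\deg({}_iE_i)=1$ for $1\le i\le n$, and $\deg({}_{i+1}E_i)=s_i$, $\deg({}_iE_{i+1})=s_i^{-1}$ for $1\le i\le n-1$. Then $X$ and $Y$ have a unique maximal common quotient grading, and it is a grading by $C_n$.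
   Context: ${}_jE_i$ is the matrix whose only non-zero entry is a $1$ in position $(j,i)$. A grading $Z$ of a $k$-algebra $A$ by a group $G$ is a decomposition $A=\bigoplus_{s\in G}Z^sA$ with $Z^tA\,Z^sA\subset Z^{ts}A$; it is connected if the support $\{s\in G: Z^sA\neq0\}$ generates $G$. The algebra $M_n(k)$ has the presentation $k\{x,y\}/\langle x^n=1,\,y^n=1,\,yx=qxy\rangle$, so the prescribed degrees define the grading $X$. The quotient of a $G$-grading $Z$ by a normal subgroup $N$ of $G$ is the $G/N$-grading $Z/N$ whose homogeneous component of degree $\alpha\in G/N$ is $\bigoplus_{g\in\alpha}Z^gA$. A common quotient of two gradings of the same algebra is a grading that is a quotient of each of them, where gradings that correspond to each other under an isomorphism of the grading groups (with the same homogeneous subspaces) are identified. A common quotient is maximal if it is not a proper quotient of another common quotient. *)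

theory Defs
  imports
    "Jordan_Normal_Form.VS_Connect"
    "HOL-Algebra.Elementary_Groups"
    "HOL-Algebra.Generated_Groups"
begin

section \<open>Gradings of an algebra by a group\<close>

text \<open>The locale \<^locale>\<open>algebra\<close> requires a commutative multiplication, so it cannot be used for
  matrix algebras. Below, an algebra is a \<^typ>\<open>('k, 'a) module\<close> record whose fields \<^const>\<open>monoid.mult\<close> and
  \<^const>\<open>monoid.one\<close> are its product and unit; the vector space laws are part of
  \<^const>\<open>VectorSpace.subspace\<close>.\<close>

definition sum_of_family :: "('a, 'm) ring_scheme \<Rightarrow> 'g set \<Rightarrow> ('g \<Rightarrow> 'a set) \<Rightarrow> 'a set" where
  "sum_of_family A I Z = {finsum A f S | f S. finite S \<and> S \<subseteq> I \<and> f \<in> Pi S Z}"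

text \<open>The third conjunct is the decomposition of the algebra as the internal direct sum of the
  family: every element is uniquely the sum of a finitely supported choice of homogeneous
  components.\<close>

definition is_grading ::
  "('k, 'r) ring_scheme \<Rightarrow> ('k, 'a, 'm) module_scheme \<Rightarrow> ('g, 'n) monoid_scheme
    \<Rightarrow> ('g \<Rightarrow> 'a set) \<Rightarrow> bool" where
  "is_grading K A G Z \<longleftrightarrow>
     group G \<and>
     (\<forall>s\<in>carrier G. VectorSpace.subspace K (Z s) A) \<and>
     (\<forall>a\<in>carrier A. \<exists>!f. f \<in> Pi\<^sub>E (carrier G) Z \<and>
        finite {s \<in> carrier G. f s \<noteq> \<zero>\<^bsub>A\<^esub>} \<and>
        a = finsum A f {s \<in> carrier G. f s \<noteq> \<zero>\<^bsub>A\<^esub>}) \<and>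
     (\<forall>t\<in>carrier G. \<forall>s\<in>carrier G. \<forall>a\<in>Z t. \<forall>b\<in>Z s. a \<otimes>\<^bsub>A\<^esub> b \<in> Z (t \<otimes>\<^bsub>G\<^esub> s))"

definition support ::
  "('a, 'm) ring_scheme \<Rightarrow> ('g, 'n) monoid_scheme \<Rightarrow> ('g \<Rightarrow> 'a set) \<Rightarrow> 'g set" where
  "support A G Z = {s \<in> carrier G. Z s \<noteq> {\<zero>\<^bsub>A\<^esub>}}"

definition is_connected_grading ::
  "('k, 'r) ring_scheme \<Rightarrow> ('k, 'a, 'm) module_scheme \<Rightarrow> ('g, 'n) monoid_scheme
    \<Rightarrow> ('g \<Rightarrow> 'a set) \<Rightarrow> bool" where
  "is_connected_grading K A G Z \<longleftrightarrow>
     is_grading K A G Z \<and> generate G (support A G Z) = carrier G"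

section \<open>Quotients and maximal common quotients\<close>

text \<open>The components of the quotient grading, indexed by the cosets that form \<^term>\<open>G Mod N\<close>.\<close>

definition quotient_grading ::
  "('a, 'm) ring_scheme \<Rightarrow> ('g \<Rightarrow> 'a set) \<Rightarrow> 'g set \<Rightarrow> 'a set" where
  "quotient_grading A Z = (\<lambda>\<alpha>. sum_of_family A \<alpha> Z)"

text \<open>The identification of gradings: an isomorphism of the grading groups that preserves the
  homogeneous subspaces.\<close>

definition same_grading ::
  "('g, 'n) monoid_scheme \<Rightarrow> ('g \<Rightarrow> 'a set) \<Rightarrow> ('h, 'p) monoid_scheme
    \<Rightarrow> ('h \<Rightarrow> 'a set) \<Rightarrow> bool" where
  "same_grading G Z H W \<longleftrightarrow> (\<exists>\<phi>\<in>iso G H. \<forall>s\<in>carrier G. W (\<phi> s) = Z s)"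

text \<open>Up to identification, the \<open>H\<close>-grading \<open>W\<close> is a quotient of the \<open>G\<close>-grading \<open>Z\<close>.\<close>

definition has_quotient ::
  "('a, 'm) ring_scheme \<Rightarrow> 'g monoid \<Rightarrow> ('g \<Rightarrow> 'a set) \<Rightarrow> 'h monoid
    \<Rightarrow> ('h \<Rightarrow> 'a set) \<Rightarrow> bool" where
  "has_quotient A G Z H W \<longleftrightarrow>
     (\<exists>N. N \<lhd> G \<and> same_grading (G Mod N) (quotient_grading A Z) H W)"

definition common_quotient ::
  "('k, 'r) ring_scheme \<Rightarrow> ('k, 'a, 'm) module_scheme
    \<Rightarrow> 'g monoid \<Rightarrow> ('g \<Rightarrow> 'a set) \<Rightarrow> 'f monoid \<Rightarrow> ('f \<Rightarrow> 'a set)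
    \<Rightarrow> 'h monoid \<Rightarrow> ('h \<Rightarrow> 'a set) \<Rightarrow> bool" where
  "common_quotient K A G X F Y H W \<longleftrightarrow>
     is_grading K A H W \<and> has_quotient A G X H W \<and> has_quotient A F Y H W"

text \<open>HOL cannot quantify over the type of the grading group \<open>H'\<close> of the competing common quotient.
  Every common quotient is identified with the grading by \<^term>\<open>G Mod N\<close> for some
  normal \<open>N\<close>, so letting \<open>H'\<close> range over all groups whose elements have the type
  \<^typ>\<open>'g set\<close> of these cosets covers all of them.\<close>

definition maximal_common_quotient ::
  "('k, 'r) ring_scheme \<Rightarrow> ('k, 'a, 'm) module_scheme
    \<Rightarrow> 'g monoid \<Rightarrow> ('g \<Rightarrow> 'a set) \<Rightarrow> 'f monoid \<Rightarrow> ('f \<Rightarrow> 'a set)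
    \<Rightarrow> 'h monoid \<Rightarrow> ('h \<Rightarrow> 'a set) \<Rightarrow> bool" where
  "maximal_common_quotient K A G X F Y H W \<longleftrightarrow>
     common_quotient K A G X F Y H W \<and>
     \<not> (\<exists>(H' :: 'g set monoid) W'.
          common_quotient K A G X F Y H' W' \<and>
          has_quotient A H' W' H W \<and> \<not> same_grading H' W' H W)"

section \<open>Free groups\<close>

text \<open>A letter \<open>(s, True)\<close> stands for the generator \<open>s\<close>, and \<open>(s, False)\<close> for its inverse; the
  elements of the free group are the reduced words.\<close>

definition inverse_letters :: "'s \<times> bool \<Rightarrow> 's \<times> bool \<Rightarrow> bool" where
  "inverse_letters a b \<longleftrightarrow> fst a = fst b \<and> snd a \<noteq> snd b"

definition reduced_word :: "('s \<times> bool) list \<Rightarrow> bool" where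
  "reduced_word = successively (\<lambda>a b. \<not> inverse_letters a b)"

fun cons_reduce :: "'s \<times> bool \<Rightarrow> ('s \<times> bool) list \<Rightarrow> ('s \<times> bool) list" where
  "cons_reduce a [] = [a]"
| "cons_reduce a (b # w) = (if inverse_letters a b then w else a # b # w)"

definition free_group :: "'s set \<Rightarrow> ('s \<times> bool) list monoid" where
  "free_group S =
     \<lparr>carrier = {w. set w \<subseteq> S \<times> UNIV \<and> reduced_word w},
      mult = (\<lambda>u v. foldr cons_reduce u v),
      one = []\<rparr>"

definition free_gen :: "'s \<Rightarrow> ('s \<times> bool) list" where
  "free_gen s = [(s, True)]"

lemma reduced_word_Cons: "reduced_word (a # w) \<longleftrightarrow> (w = [] \<or> \<not> inverse_letters a (hd w)) \<and> reduced_word w"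
  by (cases w) (auto simp: reduced_word_def)

lemma reduced_cons_reduce:
  "reduced_word w \<Longrightarrow> reduced_word (cons_reduce a w)"
  by (cases w) (auto simp: reduced_word_Cons)

lemma set_cons_reduce: "set (cons_reduce a w) \<subseteq> insert a (set w)"
  by (cases w) auto

lemma cons_reduce_cancel:
  "reduced_word w \<Longrightarrow> inverse_letters a b \<Longrightarrow> cons_reduce a (cons_reduce b w) = w"
proof (cases w)
  case (Cons c v)
  assume "reduced_word w" "inverse_letters a b"
  show ?thesis
  proof (cases "inverse_letters b c")
    case True
    then have "a = c" using \<open>inverse_letters a b\<close> by (auto simp: inverse_letters_def prod_eq_iff)
    then show ?thesis using True Cons \<open>reduced_word w\<close> by (cases v) (auto simp: reduced_word_Cons)
  qed (use Cons \<open>inverse_letters a b\<close> in auto)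
qed auto

lemma reduced_foldr_cons_reduce: "reduced_word v \<Longrightarrow> reduced_word (foldr cons_reduce u v)"
  by (induction u) (auto intro: reduced_cons_reduce)

lemma set_foldr_cons_reduce: "set (foldr cons_reduce u v) \<subseteq> set u \<union> set v"
  using set_cons_reduce by (induction u) fastforce+

lemma foldr_cons_reduce_cons_reduce:
  "reduced_word w \<Longrightarrow> foldr cons_reduce (cons_reduce a u) w = cons_reduce a (foldr cons_reduce u w)"
  by (cases u) (auto simp: cons_reduce_cancel reduced_foldr_cons_reduce)

lemma foldr_cons_reduce_assoc:
  "reduced_word w \<Longrightarrow> foldr cons_reduce (foldr cons_reduce u v) w = foldr cons_reduce u (foldr cons_reduce v w)"
  by (induction u) (auto simp: foldr_cons_reduce_cons_reduce)

lemma foldr_cons_reduce_Nil: "reduced_word u \<Longrightarrow> foldr cons_reduce u [] = u"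
proof (induction u)
  case (Cons a u) then show ?case by (cases u) (auto simp: reduced_word_Cons)
qed auto

definition inverse_letter :: "'s \<times> bool \<Rightarrow> 's \<times> bool" where
  "inverse_letter = (\<lambda>(s, b). (s, \<not> b))"

lemma foldr_cons_reduce_inverse:
  "reduced_word w \<Longrightarrow> foldr cons_reduce (rev (map inverse_letter u)) (foldr cons_reduce u w) = w"
  by (induction u arbitrary: w) (auto simp: reduced_foldr_cons_reduce cons_reduce_cancel inverse_letter_def inverse_letters_def)

lemma group_free_group: "group (free_group S)"
proof (rule groupI)
  fix x assume x: "x \<in> carrier (free_group S)"
  let ?y = "foldr cons_reduce (rev (map inverse_letter x)) []"
  have r: "reduced_word x" and s: "set x \<subseteq> S \<times> UNIV" using x by (auto simp: free_group_def)
  have "?y \<in> carrier (free_group S)"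
    using set_foldr_cons_reduce[of "rev (map inverse_letter x)" "[]"] s reduced_foldr_cons_reduce[of "[]"] 
    by (fastforce simp: free_group_def inverse_letter_def reduced_word_def)
  moreover have "foldr cons_reduce ?y x = []"
    using foldr_cons_reduce_inverse[of "[]" x] foldr_cons_reduce_assoc[OF r, of "rev (map inverse_letter x)" "[]"] foldr_cons_reduce_Nil[OF r]
    by (simp add: reduced_word_def)
  ultimately show "\<exists>y\<in>carrier (free_group S). y \<otimes>\<^bsub>free_group S\<^esub> x = \<one>\<^bsub>free_group S\<^esub>"
    by (auto simp: free_group_def)
next
  fix x y assume "x \<in> carrier (free_group S)" "y \<in> carrier (free_group S)"
  then show "x \<otimes>\<^bsub>free_group S\<^esub> y \<in> carrier (free_group S)"
    using set_foldr_cons_reduce[of x y] by (auto simp: free_group_def reduced_foldr_cons_reduce)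
qed (auto simp: free_group_def foldr_cons_reduce_assoc reduced_word_def)

section \<open>The two gradings of the matrix algebra\<close>

definition primitive_root_of_unity :: "nat \<Rightarrow> 'k::field \<Rightarrow> bool" where
  "primitive_root_of_unity n q \<longleftrightarrow> 0 < n \<and> q ^ n = 1 \<and> (\<forall>m. 0 < m \<and> m < n \<longrightarrow> q ^ m \<noteq> 1)"

abbreviation matrix_algebra :: "'k::field itself \<Rightarrow> nat \<Rightarrow> ('k, 'k mat) module" where
  "matrix_algebra ty n \<equiv> module_mat ty n n"

text \<open>Rows and columns of a \<^typ>\<open>'k mat\<close> are numbered from \<open>0\<close>, so the standard basis vector
  \<open>e\<^sub>i\<close>, for \<open>1 \<le> i \<le> n\<close>, belongs to position \<open>i - 1\<close>.\<close>

definition shift_mat :: "nat \<Rightarrow> 'k::field mat" where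
  "shift_mat n = mat n n (\<lambda>(r, c). if r = (if Suc c < n then Suc c else 0) then 1 else 0)"

definition clock_mat :: "nat \<Rightarrow> 'k::field \<Rightarrow> 'k mat" where
  "clock_mat n q = mat n n (\<lambda>(r, c). if r = c then q ^ Suc c else 0)"

definition elem_mat :: "nat \<Rightarrow> nat \<Rightarrow> nat \<Rightarrow> 'k::field mat" where
  "elem_mat n j i = mat n n (\<lambda>(r, c). if Suc r = j \<and> Suc c = i then 1 else 0)"

abbreviation cyc :: "nat \<Rightarrow> int monoid" where
  "cyc n \<equiv> integer_mod_group n"

text \<open>Reducing modulo \<open>n\<close> matters only for \<open>n = 1\<close>.\<close>

definition cyc_gen :: "nat \<Rightarrow> int" where
  "cyc_gen n = 1 mod int n"

definition is_grading_X :: "nat \<Rightarrow> 'k::field \<Rightarrow> (int \<times> int \<Rightarrow> 'k mat set) \<Rightarrow> bool" where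
  "is_grading_X n q X \<longleftrightarrow>
     is_connected_grading class_ring (matrix_algebra TYPE('k) n) (cyc n \<times>\<times> cyc n) X \<and>
     shift_mat n \<in> X (cyc_gen n, \<one>\<^bsub>cyc n\<^esub>) \<and>
     clock_mat n q \<in> X (\<one>\<^bsub>cyc n\<^esub>, cyc_gen n)"

definition is_grading_Y :: "nat \<Rightarrow> ((nat \<times> bool) list \<Rightarrow> 'k::field mat set) \<Rightarrow> bool" where
  "is_grading_Y n Y \<longleftrightarrow>
     (let F = free_group {1..<n} in
       is_connected_grading class_ring (matrix_algebra TYPE('k) n) F Y \<and>
       (\<forall>i\<in>{1..n}. \<forall>j\<in>{1..n}. \<exists>s\<in>carrier F. elem_mat n j i \<in> Y s) \<and>
       (\<forall>i\<in>{1..n}. elem_mat n i i \<in> Y \<one>\<^bsub>F\<^esub>) \<and>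
       (\<forall>i\<in>{1..<n}. elem_mat n (Suc i) i \<in> Y (free_gen i) \<and>
                    elem_mat n i (Suc i) \<in> Y (inv\<^bsub>F\<^esub> free_gen i)))"

end

theory Submission
  imports Defs
begin

text \<open>
  The largest common quotient \<open>W\<close> is the grading by cyclic diagonals: the elementary matrix in
  position \<open>(i, j)\<close> has degree \<open>i - j\<close> modulo \<open>n\<close>. It is a quotient of \<open>X\<close> by the second
  factor, because \<open>x\<^sup>s y\<^sup>t\<close> lives on the diagonal \<open>s\<close>, and a quotient of \<open>Y\<close> along the
  homomorphism that sends every free generator to the generator of \<open>C\<^sub>n\<close>
  (\<open>cyclic_quotient_of_X\<close>, \<open>cyclic_quotient_of_Y\<close>).

  Conversely, every common quotient \<open>V\<close> is a quotient of \<open>W\<close> (\<open>common_quotient_of_cyclic\<close>).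
  In \<open>Y\<close> the diagonal idempotents have trivial degree, so in \<open>V\<close> all diagonal matrices do, among
  them \<open>y\<close>. The degree map from \<open>C\<^sub>n \<times> C\<^sub>n\<close> therefore kills the second factor. An elementary matrix
  on the diagonal \<open>s\<close> is \<open>x\<^sup>s\<close> times a diagonal idempotent, so its degree in \<open>V\<close> depends on \<open>s\<close>
  only.

  A common quotient that has \<open>W\<close> as a quotient is then also a quotient of \<open>W\<close>, and since \<open>C\<^sub>n\<close> is
  finite the two agree (\<open>mutual_quotients_same\<close>): \<open>W\<close> is maximal. Any other maximal common
  quotient is a quotient of \<open>W\<close> and cannot be a proper one.

  Quotients are handled through homomorphisms instead of cosets. For gradings, \<open>W\<close> is a quotient of
  \<open>Z\<close> as soon as an epimorphism \<open>\<phi>\<close> of the grading groups satisfies \<open>Z s \<subseteq> W (\<phi> s)\<close>, since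
  directness turns the inclusions into equalities (\<open>coarsening_component\<close>). The same principle shows
  that the prescribed degrees determine \<open>X\<close> and \<open>Y\<close>, so that one explicit model of each suffices.
  For \<open>Y\<close> the model gives each elementary matrix its own degree. For \<open>X\<close> it splits
  each diagonal into the eigenspaces of conjugation by \<open>x\<close>; that these fill the diagonal is Fourier
  inversion on \<open>C\<^sub>n\<close>, which works because a field with a primitive \<open>n\<close>-th root of unity has
  \<open>n \<noteq> 0\<close>.
\<close>

section \<open>Gradings and their quotients\<close>

lemma subspaceD:
  assumes "VectorSpace.subspace K N M"
  shows "abelian_group M" "N \<subseteq> carrier M" "\<zero>\<^bsub>M\<^esub> \<in> N"
    "\<And>a b. a \<in> N \<Longrightarrow> b \<in> N \<Longrightarrow> a \<oplus>\<^bsub>M\<^esub> b \<in> N"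
    "\<And>c a. c \<in> carrier K \<Longrightarrow> a \<in> N \<Longrightarrow> c \<odot>\<^bsub>M\<^esub> a \<in> N"
proof -
  have "submodule K N M"
    using assms by (simp add: VectorSpace.subspace_def)
  then interpret submodule K N M .
  show "abelian_group M"
    using module by (rule module.axioms)
  show "N \<subseteq> carrier M" "\<zero>\<^bsub>M\<^esub> \<in> N"
    "\<And>a b. a \<in> N \<Longrightarrow> b \<in> N \<Longrightarrow> a \<oplus>\<^bsub>M\<^esub> b \<in> N"
    "\<And>c a. c \<in> carrier K \<Longrightarrow> a \<in> N \<Longrightarrow> c \<odot>\<^bsub>M\<^esub> a \<in> N"
    using subset by auto
qed

lemma subspace_finsum_closed:
  assumes "VectorSpace.subspace K N M" "f \<in> I \<rightarrow> N"
  shows "finsum M f I \<in> N"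
proof -
  interpret abelian_group M
    using subspaceD(1)[OF assms(1)] .
  show ?thesis
    using assms(2)
  proof (induction I rule: infinite_finite_induct)
    case (insert x I)
    moreover have "f \<in> I \<rightarrow> carrier M" "f x \<in> carrier M"
      using insert.prems subspaceD(2)[OF assms(1)] by auto
    ultimately show ?case
      by (auto intro: subspaceD(4)[OF assms(1)])
  qed (auto intro: subspaceD(3)[OF assms(1)])
qed

lemma is_gradingD:
  assumes "is_grading K A G Z"
  shows "group G" "\<And>s. s \<in> carrier G \<Longrightarrow> VectorSpace.subspace K (Z s) A"
    "\<And>s t a b. \<lbrakk>s \<in> carrier G; t \<in> carrier G; a \<in> Z s; b \<in> Z t\<rbrakk> \<Longrightarrow> a \<otimes>\<^bsub>A\<^esub> b \<in> Z (s \<otimes>\<^bsub>G\<^esub> t)"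
  using assms by (auto simp: is_grading_def)

lemma grading_abelian_group: "is_grading K A G Z \<Longrightarrow> abelian_group A"
  by (meson is_gradingD group.is_monoid monoid.one_closed subspaceD(1))

lemma grading_carrier: "\<lbrakk>is_grading K A G Z; s \<in> carrier G; a \<in> Z s\<rbrakk> \<Longrightarrow> a \<in> carrier A"
  using is_gradingD(2) subspaceD(2) by fast

lemma grading_decomposition:
  assumes Z: "is_grading K A G Z" and a: "a \<in> carrier A"
  obtains S f where "finite S" "S \<subseteq> carrier G" "f \<in> Pi S Z" "a = finsum A f S"
proof -
  obtain f where "f \<in> Pi\<^sub>E (carrier G) Z" "finite {s \<in> carrier G. f s \<noteq> \<zero>\<^bsub>A\<^esub>}"
    "a = finsum A f {s \<in> carrier G. f s \<noteq> \<zero>\<^bsub>A\<^esub>}"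
    using Z a unfolding is_grading_def by blast
  then show ?thesis
    by (intro that[of "{s \<in> carrier G. f s \<noteq> \<zero>\<^bsub>A\<^esub>}" f]) auto
qed

text \<open>The form in which directness of the sum is used below: two finite sums of homogeneous elements
  may be compared over any common finite index set, whether or not the summands vanish.\<close>

lemma grading_components_unique:
  assumes Z: "is_grading K A G Z" and T: "finite T" "T \<subseteq> carrier G"
    and f: "f \<in> Pi T Z" and g: "g \<in> Pi T Z" and eq: "finsum A f T = finsum A g T" and s: "s \<in> T"
  shows "f s = g s"
proof -
  interpret abelian_group A
    using Z by (rule grading_abelian_group)
  \<comment> \<open>extension by zero from \<open>T\<close> to the whole group, as the definition of a grading asks for\<close>
  define ext where "ext h = (\<lambda>s\<in>carrier G. if s \<in> T then h s else \<zero>\<^bsub>A\<^esub>)" for h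
  have ext: "ext h \<in> Pi\<^sub>E (carrier G) Z \<and> finite {s \<in> carrier G. ext h s \<noteq> \<zero>\<^bsub>A\<^esub>} \<and>
      finsum A h T = finsum A (ext h) {s \<in> carrier G. ext h s \<noteq> \<zero>\<^bsub>A\<^esub>}" if h: "h \<in> Pi T Z" for h
  proof (intro conjI)
    show "ext h \<in> Pi\<^sub>E (carrier G) Z"
      using h subspaceD(3)[OF is_gradingD(2)[OF Z]] by (auto simp: ext_def)
    have supp: "{s \<in> carrier G. ext h s \<noteq> \<zero>\<^bsub>A\<^esub>} \<subseteq> T"
      by (auto simp: ext_def)
    then show "finite {s \<in> carrier G. ext h s \<noteq> \<zero>\<^bsub>A\<^esub>}"
      using T(1) finite_subset by blast
    show "finsum A h T = finsum A (ext h) {s \<in> carrier G. ext h s \<noteq> \<zero>\<^bsub>A\<^esub>}"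
      using T h supp by (intro add.finprod_mono_neutral_cong_right)
        (auto simp: ext_def intro: grading_carrier[OF Z])
  qed
  have "finsum A f T \<in> carrier A"
    using f T grading_carrier[OF Z] by (intro finsum_closed) blast
  then have "\<exists>!h. h \<in> Pi\<^sub>E (carrier G) Z \<and> finite {s \<in> carrier G. h s \<noteq> \<zero>\<^bsub>A\<^esub>} \<and>
      finsum A f T = finsum A h {s \<in> carrier G. h s \<noteq> \<zero>\<^bsub>A\<^esub>}" (is "\<exists>!h. ?Q h")
    using Z unfolding is_grading_def by blast
  then obtain h where h: "\<And>h'. ?Q h' \<Longrightarrow> h' = h"
    by (elim ex1E) blast
  have "?Q (ext g)"
    unfolding eq using ext[OF g] .
  then have "ext f = ext g"
    using h[of "ext g"] h[of "ext f", OF ext[OF f]] by simp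
  from fun_cong[OF this, of s] show ?thesis
    using s T by (auto simp: ext_def)
qed

lemma grading_components_disjoint:
  assumes Z: "is_grading K A G Z" and s: "s \<in> carrier G" "a \<in> Z s" and t: "t \<in> carrier G" "a \<in> Z t"
    and "a \<noteq> \<zero>\<^bsub>A\<^esub>"
  shows "s = t"
proof (rule ccontr)
  assume "s \<noteq> t"
  interpret abelian_group A
    using Z by (rule grading_abelian_group)
  define f where "f = (\<lambda>x. if x = s then a else \<zero>\<^bsub>A\<^esub>)"
  define g where "g = (\<lambda>x. if x = t then a else \<zero>\<^bsub>A\<^esub>)"
  have a: "a \<in> carrier A" and zero: "\<zero>\<^bsub>A\<^esub> \<in> Z s" "\<zero>\<^bsub>A\<^esub> \<in> Z t"
    using grading_carrier[OF Z] subspaceD(3)[OF is_gradingD(2)[OF Z]] s t by auto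
  have "f \<in> Pi {s, t} Z" "g \<in> Pi {s, t} Z" "finsum A f {s, t} = finsum A g {s, t}"
    using s t zero a \<open>s \<noteq> t\<close> by (auto simp: f_def g_def)
  then have "f s = g s"
    using grading_components_unique[OF Z, of "{s, t}" f g s] s t by simp
  then show False
    using \<open>s \<noteq> t\<close> \<open>a \<noteq> \<zero>\<^bsub>A\<^esub>\<close> by (auto simp: f_def g_def)
qed

text \<open>To establish a grading it is easier to exhibit additive projections onto the components than to
  prove uniqueness of decompositions by hand: applying the projection of degree \<open>s\<close> to a
  decomposition of \<open>a\<close> recovers its summand of degree \<open>s\<close>.\<close>

lemma is_grading_by_projections:
  assumes G: "group G" and sub: "\<And>s. s \<in> carrier G \<Longrightarrow> VectorSpace.subspace K (Z s) A"
    and mult: "\<And>s t a b. \<lbrakk>s \<in> carrier G; t \<in> carrier G; a \<in> Z s; b \<in> Z t\<rbrakk>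
      \<Longrightarrow> a \<otimes>\<^bsub>A\<^esub> b \<in> Z (s \<otimes>\<^bsub>G\<^esub> t)"
    and T: "finite T" "T \<subseteq> carrier G"
    and P: "\<And>s a. s \<in> carrier G \<Longrightarrow> a \<in> carrier A \<Longrightarrow> P s a \<in> Z s"
    and add: "\<And>s a b. \<lbrakk>s \<in> carrier G; a \<in> carrier A; b \<in> carrier A\<rbrakk>
      \<Longrightarrow> P s (a \<oplus>\<^bsub>A\<^esub> b) = P s a \<oplus>\<^bsub>A\<^esub> P s b"
    and ortho: "\<And>s t a. \<lbrakk>s \<in> carrier G; t \<in> carrier G; a \<in> Z t\<rbrakk>
      \<Longrightarrow> P s a = (if s = t then a else \<zero>\<^bsub>A\<^esub>)"
    and zero: "\<And>s a. \<lbrakk>s \<in> carrier G - T; a \<in> carrier A\<rbrakk> \<Longrightarrow> P s a = \<zero>\<^bsub>A\<^esub>"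
    and sum: "\<And>a. a \<in> carrier A \<Longrightarrow> finsum A (\<lambda>s. P s a) T = a"
  shows "is_grading K A G Z"
proof -
  interpret G: group G by (rule G)
  interpret abelian_group A
    using subspaceD(1)[OF sub[OF G.one_closed]] .
  have inA: "a \<in> carrier A" if "s \<in> carrier G" "a \<in> Z s" for s a
    using that subspaceD(2)[OF sub] by blast
  have P_finsum: "P s (finsum A f S) = (if s \<in> S then f s else \<zero>\<^bsub>A\<^esub>)"
    if "finite S" "S \<subseteq> carrier G" "f \<in> Pi S Z" "s \<in> carrier G" for s f S
    using that(1-3)
  proof (induction S)
    case empty
    then show ?case
      using ortho[OF that(4) that(4), of "\<zero>\<^bsub>A\<^esub>"] subspaceD(3)[OF sub[OF that(4)]] by auto
  next
    case (insert x S)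
    have c: "f \<in> S \<rightarrow> carrier A" "f x \<in> carrier A"
      using insert.prems inA by (auto simp: Pi_iff)
    then have "P s (finsum A f (insert x S)) = P s (f x) \<oplus>\<^bsub>A\<^esub> P s (finsum A f S)"
      using insert.hyps that(4) by (simp add: add)
    then show ?case
      using insert c ortho[OF that(4), of x "f x"] by (auto simp: Pi_iff)
  qed
  have "\<exists>!f. f \<in> Pi\<^sub>E (carrier G) Z \<and> finite {s \<in> carrier G. f s \<noteq> \<zero>\<^bsub>A\<^esub>} \<and>
      a = finsum A f {s \<in> carrier G. f s \<noteq> \<zero>\<^bsub>A\<^esub>}" if a: "a \<in> carrier A" for a
  proof (rule ex1I[of _ "\<lambda>s\<in>carrier G. P s a"], intro conjI)
    let ?f = "\<lambda>s\<in>carrier G. P s a"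
    have supp: "{s \<in> carrier G. ?f s \<noteq> \<zero>\<^bsub>A\<^esub>} \<subseteq> T"
      using zero a by auto
    show "?f \<in> Pi\<^sub>E (carrier G) Z"
      using P a by auto
    show "finite {s \<in> carrier G. ?f s \<noteq> \<zero>\<^bsub>A\<^esub>}"
      using supp T(1) finite_subset by blast
    have "finsum A ?f {s \<in> carrier G. ?f s \<noteq> \<zero>\<^bsub>A\<^esub>} = finsum A (\<lambda>s. P s a) T"
      using T a supp by (intro add.finprod_mono_neutral_cong_left) (auto intro: inA P)
    then show "a = finsum A ?f {s \<in> carrier G. ?f s \<noteq> \<zero>\<^bsub>A\<^esub>}"
      using sum[OF a] by simp
  next
    fix f
    assume f: "f \<in> Pi\<^sub>E (carrier G) Z \<and> finite {s \<in> carrier G. f s \<noteq> \<zero>\<^bsub>A\<^esub>} \<and>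
      a = finsum A f {s \<in> carrier G. f s \<noteq> \<zero>\<^bsub>A\<^esub>}"
    show "f = (\<lambda>s\<in>carrier G. P s a)"
    proof
      fix s
      show "f s = (\<lambda>s\<in>carrier G. P s a) s"
      proof (cases "s \<in> carrier G")
        case True
        then have "P s (finsum A f {s \<in> carrier G. f s \<noteq> \<zero>\<^bsub>A\<^esub>}) = f s"
          using f by (subst P_finsum) auto
        then show ?thesis
          using f True by simp
      qed (use f in \<open>auto simp: PiE_iff extensional_def\<close>)
    qed
  qed
  then show ?thesis
    unfolding is_grading_def using G sub mult by blast
qed

text \<open>Inclusion of components forces equality here. An element of \<open>W h\<close> decomposes into
  \<open>Z\<close>-homogeneous summands; collecting them along the fibres of \<open>\<phi>\<close> gives a
  decomposition with respect to \<open>W\<close>, which by uniqueness has only its part of degree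
  \<open>h\<close>.\<close>

lemma coarsening_component:
  assumes Z: "is_grading K A G Z" and W: "is_grading K A H W"
    and \<phi>: "\<phi> \<in> hom G H" and le: "\<And>s. s \<in> carrier G \<Longrightarrow> Z s \<subseteq> W (\<phi> s)"
    and h: "h \<in> carrier H"
  shows "W h = sum_of_family A {s \<in> carrier G. \<phi> s = h} Z"
proof
  interpret abelian_group A
    using Z by (rule grading_abelian_group)
  have \<phi>c: "\<phi> s \<in> carrier H" if "s \<in> carrier G" for s
    using \<phi> that by (auto simp: hom_def)
  show "sum_of_family A {s \<in> carrier G. \<phi> s = h} Z \<subseteq> W h"
  proof
    fix a assume "a \<in> sum_of_family A {s \<in> carrier G. \<phi> s = h} Z"
    then obtain f S where "S \<subseteq> {s \<in> carrier G. \<phi> s = h}" "f \<in> Pi S Z" "a = finsum A f S"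
      by (auto simp: sum_of_family_def)
    moreover from this have "f \<in> S \<rightarrow> W h"
      using le by blast
    ultimately show "a \<in> W h"
      using subspace_finsum_closed[OF is_gradingD(2)[OF W h]] by simp
  qed
  show "W h \<subseteq> sum_of_family A {s \<in> carrier G. \<phi> s = h} Z"
  proof
    fix a assume aW: "a \<in> W h"
    then have a: "a \<in> carrier A"
      using grading_carrier[OF W h] by blast
    obtain S f where S: "finite S" "S \<subseteq> carrier G" and f: "f \<in> Pi S Z" and af: "a = finsum A f S"
      by (rule grading_decomposition[OF Z a])
    have fc: "f s \<in> carrier A" if "s \<in> S" for s
      using that f S grading_carrier[OF Z] by blast
    define b where "b h' = finsum A f {s \<in> S. \<phi> s = h'}" for h'
    let ?T = "insert h (\<phi> ` S)"
    have b: "b \<in> Pi ?T W"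
    proof
      fix h' assume "h' \<in> ?T"
      then have "h' \<in> carrier H"
        using h S \<phi>c by auto
      then show "b h' \<in> W h'"
        unfolding b_def using f S le by (intro subspace_finsum_closed[OF is_gradingD(2)[OF W]]) blast+
    qed
    have "finsum A b ?T = finsum A f (\<Union>h'\<in>?T. {s \<in> S. \<phi> s = h'})"
      unfolding b_def using S fc
      by (intro add.finprod_UN_disjoint[symmetric]) (auto simp: pairwise_def disjnt_def)
    also have "(\<Union>h'\<in>?T. {s \<in> S. \<phi> s = h'}) = S"
      by auto
    finally have "finsum A b ?T = a"
      using af by simp
    moreover have "finsum A (\<lambda>h'. if h' = h then a else \<zero>\<^bsub>A\<^esub>) ?T = a"
      using S a add.finprod_singleton_swap[of h ?T "\<lambda>_. a"] by auto
    moreover have "(\<lambda>h'. if h' = h then a else \<zero>\<^bsub>A\<^esub>) \<in> Pi ?T W"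
      using h S \<phi>c aW subspaceD(3)[OF is_gradingD(2)[OF W]] by auto
    moreover have "finite ?T" "?T \<subseteq> carrier H"
      using h S \<phi>c by auto
    ultimately have "b h = a"
      using grading_components_unique[OF W, of ?T b "\<lambda>h'. if h' = h then a else \<zero>\<^bsub>A\<^esub>" h] b by simp
    then show "a \<in> sum_of_family A {s \<in> carrier G. \<phi> s = h} Z"
      using S f by (auto simp: sum_of_family_def b_def intro!: exI[of _ f] exI[of _ "{s \<in> S. \<phi> s = h}"])
  qed
qed

lemma coarsening_along_injective:
  assumes Z: "is_grading K A G Z" and W: "is_grading K A H W"
    and \<phi>: "\<phi> \<in> hom G H" and inj: "inj_on \<phi> (carrier G)"
    and le: "\<And>s. s \<in> carrier G \<Longrightarrow> Z s \<subseteq> W (\<phi> s)" and s: "s \<in> carrier G"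
  shows "W (\<phi> s) = Z s"
proof
  have "\<phi> s \<in> carrier H"
    using \<phi> s by (auto simp: hom_def)
  then have "W (\<phi> s) = sum_of_family A {t \<in> carrier G. \<phi> t = \<phi> s} Z"
    using le by (intro coarsening_component[OF Z W \<phi>]) auto
  also have "{t \<in> carrier G. \<phi> t = \<phi> s} = {s}"
    using inj s by (auto simp: inj_on_def)
  also have "sum_of_family A {s} Z \<subseteq> Z s"
  proof
    fix a assume "a \<in> sum_of_family A {s} Z"
    then obtain f S where "S \<subseteq> {s}" "f \<in> Pi S Z" "a = finsum A f S"
      by (auto simp: sum_of_family_def)
    moreover from this have "f \<in> S \<rightarrow> Z s"
      by blast
    ultimately show "a \<in> Z s"
      using subspace_finsum_closed[OF is_gradingD(2)[OF Z s]] by simp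
  qed
  finally show "W (\<phi> s) \<subseteq> Z s" .
qed (use le s in blast)

text \<open>This is why prescribing the degrees of algebra generators determines a grading: if the prescribed
  degrees force every component of one grading \<open>Z\<close> into the corresponding component of
  \<open>W\<close>, nothing is left over.\<close>

lemma grading_le_imp_eq:
  assumes "is_grading K A G Z" "is_grading K A G W" "\<And>s. s \<in> carrier G \<Longrightarrow> Z s \<subseteq> W s" "s \<in> carrier G"
  shows "W s = Z s"
  using coarsening_along_injective[of K A G Z G W id s] assms by (simp add: hom_def)

text \<open>Together with \<open>has_quotientE\<close> this replaces cosets by homomorphisms: \<open>W\<close> is a quotient of
  \<open>Z\<close> if and only if some epimorphism \<open>\<phi>\<close> of the grading groups satisfies
  \<open>Z s \<subseteq> W (\<phi> s)\<close>. The normal subgroup is the kernel, its cosets are the fibres of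
  \<open>\<phi>\<close>, and the components agree by \<open>coarsening_component\<close>.\<close>

lemma has_quotientI:
  assumes Z: "is_grading K A G Z" and W: "is_grading K A H W"
    and \<phi>: "\<phi> \<in> epi G H" and le: "\<And>s. s \<in> carrier G \<Longrightarrow> Z s \<subseteq> W (\<phi> s)"
  shows "has_quotient A G Z H W"
proof -
  have hom: "\<phi> \<in> hom G H" and onto: "\<phi> ` carrier G = carrier H"
    using \<phi> by (auto simp: epi_def)
  interpret group_hom G H \<phi>
    using is_gradingD(1)[OF Z] is_gradingD(1)[OF W] hom
    by (simp add: group_hom_def group_hom_axioms_def)
  let ?N = "kernel G H \<phi>"
  have "W (the_elem (\<phi> ` \<alpha>)) = quotient_grading A Z \<alpha>" if \<alpha>: "\<alpha> \<in> carrier (G Mod ?N)" for \<alpha>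
  proof -
    obtain g where g: "g \<in> carrier G" and \<alpha>g: "\<alpha> = ?N #>\<^bsub>G\<^esub> g"
      using \<alpha> by (auto simp: FactGroup_def RCOSETS_def)
    have \<alpha>': "\<alpha> = {s \<in> carrier G. \<phi> s = \<phi> g}"
    proof
      show "\<alpha> \<subseteq> {s \<in> carrier G. \<phi> s = \<phi> g}"
        using g by (auto simp: \<alpha>g r_coset_def kernel_def)
      show "{s \<in> carrier G. \<phi> s = \<phi> g} \<subseteq> \<alpha>"
      proof
        fix s assume s: "s \<in> {s \<in> carrier G. \<phi> s = \<phi> g}"
        then have "s \<in> ?N #>\<^bsub>G\<^esub> s"
          by (intro G.rcos_self subgroup_kernel) auto
        then show "s \<in> \<alpha>"
          using FactGroup_subset[of s g] s g by (auto simp: \<alpha>g)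
      qed
    qed
    then have "\<phi> ` \<alpha> = {\<phi> g}"
      using g by auto
    then have "W (the_elem (\<phi> ` \<alpha>)) = W (\<phi> g)"
      by simp
    also have "\<dots> = sum_of_family A \<alpha> Z"
      unfolding \<alpha>' using g le by (intro coarsening_component[OF Z W hom]) auto
    finally show ?thesis
      by (simp add: quotient_grading_def)
  qed
  then have "same_grading (G Mod ?N) (quotient_grading A Z) H W"
    unfolding same_grading_def by (intro bexI[OF _ FactGroup_iso_set[OF onto]] ballI)
  then show ?thesis
    unfolding has_quotient_def by (intro exI[of _ ?N] conjI normal_kernel)
qed

lemma has_quotientE:
  assumes Z: "is_grading K A G Z" and Q: "has_quotient A G Z H W"
  obtains \<phi> where "\<phi> \<in> epi G H" "\<forall>s\<in>carrier G. Z s \<subseteq> W (\<phi> s)"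
proof -
  interpret abelian_group A
    using Z by (rule grading_abelian_group)
  obtain N \<kappa> where N: "N \<lhd> G" and \<kappa>: "\<kappa> \<in> iso (G Mod N) H"
    and W: "\<And>\<alpha>. \<alpha> \<in> carrier (G Mod N) \<Longrightarrow> W (\<kappa> \<alpha>) = quotient_grading A Z \<alpha>"
    using Q unfolding has_quotient_def same_grading_def by blast
  interpret N: normal N G by (rule N)
  let ?\<phi> = "\<lambda>s. \<kappa> (N #>\<^bsub>G\<^esub> s)"
  have cosets: "carrier (G Mod N) = (\<lambda>s. N #>\<^bsub>G\<^esub> s) ` carrier G"
    by (auto simp: FactGroup_def RCOSETS_def)
  have "\<kappa> \<circ> (\<lambda>s. N #>\<^bsub>G\<^esub> s) \<in> hom G H"
    using N.r_coset_hom_Mod \<kappa> by (intro Group.hom_compose) (auto simp: iso_def)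
  moreover have "?\<phi> ` carrier G = carrier H"
    using \<kappa> by (auto simp: iso_def bij_betw_def cosets image_image)
  ultimately have "?\<phi> \<in> epi G H"
    by (simp add: epi_def comp_def)
  moreover have "Z s \<subseteq> W (?\<phi> s)" if s: "s \<in> carrier G" for s
  proof
    fix a assume a: "a \<in> Z s"
    have "N #>\<^bsub>G\<^esub> s \<in> carrier (G Mod N)"
      using s by (auto simp: cosets)
    moreover have "s \<in> N #>\<^bsub>G\<^esub> s"
      using s N.subgroup_axioms by (rule N.rcos_self)
    ultimately show "a \<in> W (?\<phi> s)"
      using a grading_carrier[OF Z s a]
      by (auto simp: W quotient_grading_def sum_of_family_def intro!: exI[of _ "\<lambda>_. a"] exI[of _ "{s}"])
  qed
  ultimately show ?thesis
    by (intro that[of ?\<phi>] ballI)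
qed

lemma epi_compose:
  assumes "\<phi> \<in> epi G H" "\<psi> \<in> epi H L"
  shows "\<psi> \<circ> \<phi> \<in> epi G L"
proof -
  have "\<psi> \<circ> \<phi> \<in> hom G L"
    using assms by (intro Group.hom_compose) (auto simp: epi_def)
  moreover have "(\<psi> \<circ> \<phi>) ` carrier G = carrier L"
    using assms unfolding epi_def image_comp [symmetric] by simp
  ultimately show ?thesis
    by (simp add: epi_def)
qed

lemma has_quotient_trans:
  assumes "is_grading K A G Z" "is_grading K A H W" "is_grading K A L V"
    and "has_quotient A G Z H W" "has_quotient A H W L V"
  shows "has_quotient A G Z L V"
proof -
  obtain \<phi> where \<phi>: "\<phi> \<in> epi G H" "\<forall>s\<in>carrier G. Z s \<subseteq> W (\<phi> s)"
    by (rule has_quotientE[OF assms(1,4)])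
  obtain \<psi> where \<psi>: "\<psi> \<in> epi H L" "\<forall>s\<in>carrier H. W s \<subseteq> V (\<psi> s)"
    by (rule has_quotientE[OF assms(2,5)])
  show ?thesis
  proof (rule has_quotientI[OF assms(1,3) epi_compose[OF \<phi>(1) \<psi>(1)]])
    fix s assume s: "s \<in> carrier G"
    then have "\<phi> s \<in> carrier H"
      using \<phi>(1) by (auto simp: epi_def)
    then have "Z s \<subseteq> W (\<phi> s)" "W (\<phi> s) \<subseteq> V (\<psi> (\<phi> s))"
      using \<phi>(2) \<psi>(2) s by simp_all
    then show "Z s \<subseteq> V ((\<psi> \<circ> \<phi>) s)"
      by simp
  qed
qed

lemma same_grading_sym:
  assumes "group G" "same_grading G Z H W"
  shows "same_grading H W G Z"
proof -
  obtain \<phi> where \<phi>: "\<phi> \<in> iso G H" "\<And>s. s \<in> carrier G \<Longrightarrow> W (\<phi> s) = Z s"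
    using assms(2) by (auto simp: same_grading_def)
  let ?\<psi> = "inv_into (carrier G) \<phi>"
  have bij: "bij_betw \<phi> (carrier G) (carrier H)"
    using \<phi>(1) by (simp add: iso_def)
  have "Z (?\<psi> h) = W h" if "h \<in> carrier H" for h
    using \<phi>(2)[of "?\<psi> h"] that bij_betw_inv_into_right[OF bij that]
      bij_betw_apply[OF bij_betw_inv_into[OF bij] that] by simp
  then show ?thesis
    using group.iso_set_sym[OF assms(1) \<phi>(1)] by (auto simp: same_grading_def)
qed

lemma same_grading_trans:
  assumes "same_grading G Z H W" "same_grading H W L V"
  shows "same_grading G Z L V"
proof -
  obtain \<phi> where \<phi>: "\<phi> \<in> iso G H" "\<And>s. s \<in> carrier G \<Longrightarrow> W (\<phi> s) = Z s"
    using assms(1) by (auto simp: same_grading_def)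
  obtain \<psi> where \<psi>: "\<psi> \<in> iso H L" "\<And>s. s \<in> carrier H \<Longrightarrow> V (\<psi> s) = W s"
    using assms(2) by (auto simp: same_grading_def)
  have "V ((\<psi> \<circ> \<phi>) s) = Z s" if "s \<in> carrier G" for s
    using \<phi> \<psi>(2)[of "\<phi> s"] that by (auto simp: iso_def bij_betw_def)
  then show ?thesis
    using iso_set_trans[OF \<phi>(1) \<psi>(1)] unfolding same_grading_def by blast
qed

lemma same_grading_imp_has_quotient:
  assumes "is_grading K A G Z" "is_grading K A H W" "same_grading G Z H W"
  shows "has_quotient A G Z H W"
proof -
  obtain \<phi> where \<phi>: "\<phi> \<in> iso G H" "\<And>s. s \<in> carrier G \<Longrightarrow> W (\<phi> s) = Z s"
    using assms(3) by (auto simp: same_grading_def)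
  then show ?thesis
    by (intro has_quotientI[OF assms(1,2), of \<phi>]) (auto simp: iso_def epi_def bij_betw_def)
qed

text \<open>Finiteness is essential: two epimorphisms in opposite directions give the groups the same finite
  order, which makes both of them injective. Infinite groups can be proper quotients of each other.\<close>

lemma mutual_quotients_same:
  assumes Z: "is_grading K A G Z" and W: "is_grading K A H W" and fin: "finite (carrier G)"
    and "has_quotient A G Z H W" "has_quotient A H W G Z"
  shows "same_grading G Z H W"
proof -
  obtain \<phi> where \<phi>: "\<phi> \<in> epi G H" "\<forall>s\<in>carrier G. Z s \<subseteq> W (\<phi> s)"
    by (rule has_quotientE[OF Z assms(4)])
  obtain \<psi> where \<psi>: "\<psi> \<in> epi H G"
    by (rule has_quotientE[OF W assms(5)])
  have \<phi>_hom: "\<phi> \<in> hom G H" and \<phi>_onto: "\<phi> ` carrier G = carrier H" and \<psi>_onto: "\<psi> ` carrier H = carrier G"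
    using \<phi>(1) \<psi> by (simp_all add: epi_def)
  have "card (carrier H) = card (carrier G)"
    using card_image_le[OF fin, of \<phi>] card_image_le[of "carrier H" \<psi>] finite_imageI[OF fin, of \<phi>]
    unfolding \<phi>_onto \<psi>_onto by simp
  then have inj: "inj_on \<phi> (carrier G)"
    using fin \<phi>_onto by (simp add: eq_card_imp_inj_on)
  then have "\<phi> \<in> iso G H"
    using \<phi>_hom \<phi>_onto by (simp add: iso_def bij_betw_def)
  moreover have "\<forall>s\<in>carrier G. W (\<phi> s) = Z s"
    using \<phi>(2) by (intro ballI coarsening_along_injective[OF Z W \<phi>_hom inj]) auto
  ultimately show ?thesis
    unfolding same_grading_def by (intro bexI)
qed

lemma finsum_mat_index:
  fixes f :: "'i \<Rightarrow> 'k::field mat"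
  assumes "f \<in> I \<rightarrow> carrier_mat n n" "i < n" "j < n"
  shows "finsum (module_mat TYPE('k) n n) f I $$ (i, j) = (\<Sum>x\<in>I. f x $$ (i, j))"
proof -
  interpret abelian_group "module_mat TYPE('k) n n"
    by (rule abelian_group_mat)
  have *: "x \<in> carrier (module_mat TYPE('k) n n) \<longleftrightarrow> x \<in> carrier_mat n n" for x
    by (simp add: module_mat_simps)
  show ?thesis
    using assms(1)
  proof (induction I rule: infinite_finite_induct)
    case (insert x I)
    then have "f \<in> I \<rightarrow> carrier (module_mat TYPE('k) n n)" "f x \<in> carrier (module_mat TYPE('k) n n)"
      by (auto simp: *)
    moreover from this have "finsum (module_mat TYPE('k) n n) f I \<in> carrier_mat n n"
      using finsum_closed by (simp add: *)
    ultimately show ?case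
      using insert assms(2,3) by (simp add: module_mat_simps)
  qed (use assms(2,3) in \<open>auto simp: module_mat_simps\<close>)
qed

lemma subspace_matI:
  fixes N :: "'k::field mat set"
  assumes "N \<subseteq> carrier_mat n n" "0\<^sub>m n n \<in> N" "\<And>A B. A \<in> N \<Longrightarrow> B \<in> N \<Longrightarrow> A + B \<in> N"
    "\<And>c A. A \<in> N \<Longrightarrow> c \<cdot>\<^sub>m A \<in> N"
  shows "VectorSpace.subspace class_ring N (module_mat TYPE('k) n n)"
proof -
  have "submodule class_ring N (module_mat TYPE('k) n n)"
    using assms matrix_vs[of n n, where 'a='k]
    by (simp add: submodule_def module_mat_simps vectorspace_def)
  then show ?thesis
    using matrix_vs by (simp add: VectorSpace.subspace_def)
qed

section \<open>Elementary gradings\<close>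

lemma elem_mat_carrier [simp]: "elem_mat n i j \<in> carrier_mat n n"
  by (simp add: elem_mat_def)

lemma elem_mat_dim [simp]: "dim_row (elem_mat n i j) = n" "dim_col (elem_mat n i j) = n"
  by (simp_all add: elem_mat_def)

lemma elem_mat_index [simp]:
  "r < n \<Longrightarrow> c < n \<Longrightarrow> elem_mat n i j $$ (r, c) = (if Suc r = i \<and> Suc c = j then 1 else 0)"
  by (simp add: elem_mat_def)

lemma mat_mult_index:
  fixes A :: "'k::field mat"
  assumes "A \<in> carrier_mat n n" "B \<in> carrier_mat n n" "i < n" "l < n"
  shows "(A * B) $$ (i, l) = (\<Sum>j<n. A $$ (i, j) * B $$ (j, l))"
  using assms by (simp add: scalar_prod_def atLeast0LessThan)

lemma elem_mat_mult_left_index: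
  fixes B :: "'k::field mat"
  assumes "B \<in> carrier_mat n n" "i < n" "j < n" "r < n" "c < n"
  shows "(elem_mat n (Suc i) (Suc j) * B) $$ (r, c) = (if r = i then B $$ (j, c) else 0)"
proof -
  have "(elem_mat n (Suc i) (Suc j) * B) $$ (r, c) = (\<Sum>x<n. elem_mat n (Suc i) (Suc j) $$ (r, x) * B $$ (x, c))"
    using assms by (intro mat_mult_index) auto
  also have "\<dots> = (\<Sum>x<n. if x = j then (if r = i then B $$ (x, c) else 0) else 0)"
    using assms by (intro sum.cong) auto
  finally show ?thesis
    using assms by simp
qed

lemma elem_mat_mult_right_index:
  fixes B :: "'k::field mat"
  assumes "B \<in> carrier_mat n n" "i < n" "j < n" "r < n" "c < n"
  shows "(B * elem_mat n (Suc i) (Suc j)) $$ (r, c) = (if c = j then B $$ (r, i) else 0)"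
proof -
  have "(B * elem_mat n (Suc i) (Suc j)) $$ (r, c) = (\<Sum>x<n. B $$ (r, x) * elem_mat n (Suc i) (Suc j) $$ (x, c))"
    using assms by (intro mat_mult_index) auto
  also have "\<dots> = (\<Sum>x<n. if x = i then (if c = j then B $$ (r, x) else 0) else 0)"
    using assms by (intro sum.cong) auto
  finally show ?thesis
    using assms by simp
qed

lemma elem_mat_mult:
  assumes "i < n" "j < n" "l < n"
  shows "elem_mat n (Suc i) (Suc j) * elem_mat n (Suc j) (Suc l) = (elem_mat n (Suc i) (Suc l) :: 'k::field mat)"
proof (rule eq_matI)
  fix r c
  assume "r < dim_row (elem_mat n (Suc i) (Suc l) :: 'k mat)" "c < dim_col (elem_mat n (Suc i) (Suc l) :: 'k mat)"
  then have "r < n" "c < n"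
    by (simp_all add: elem_mat_def)
  then show "(elem_mat n (Suc i) (Suc j) * elem_mat n (Suc j) (Suc l)) $$ (r, c)
      = (elem_mat n (Suc i) (Suc l) :: 'k mat) $$ (r, c)"
    using assms by (subst elem_mat_mult_left_index) auto
qed (simp_all add: elem_mat_def)

text \<open>Membership of a matrix in a homogeneous component can thus be checked on the positions of its
  non-zero entries.\<close>

lemma in_subspace_of_elem_mats:
  fixes A :: "'k::field mat"
  assumes N: "VectorSpace.subspace class_ring N (module_mat TYPE('k) n n)" and A: "A \<in> carrier_mat n n"
    and E: "\<And>i j. i < n \<Longrightarrow> j < n \<Longrightarrow> A $$ (i, j) \<noteq> 0 \<Longrightarrow> elem_mat n (Suc i) (Suc j) \<in> N"
  shows "A \<in> N"
proof -
  define f where "f = (\<lambda>(i, j). if A $$ (i, j) = 0 then 0\<^sub>m n n else A $$ (i, j) \<cdot>\<^sub>m elem_mat n (Suc i) (Suc j))"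
  let ?I = "{..<n} \<times> {..<n}"
  have fN: "f \<in> ?I \<rightarrow> N"
    using E subspaceD(5)[OF N] subspaceD(3)[OF N]
    by (auto simp: f_def module_mat_simps class_ring_simps)
  have fc: "f \<in> ?I \<rightarrow> carrier_mat n n"
    by (auto simp: f_def)
  have N': "finsum (module_mat TYPE('k) n n) f ?I \<in> N"
    by (rule subspace_finsum_closed[OF N fN])
  then have c: "finsum (module_mat TYPE('k) n n) f ?I \<in> carrier_mat n n"
    using subspaceD(2)[OF N] by (auto simp: module_mat_simps)
  have "A = finsum (module_mat TYPE('k) n n) f ?I"
  proof (rule eq_matI)
    fix r s
    assume "r < dim_row (finsum (module_mat TYPE('k) n n) f ?I)" "s < dim_col (finsum (module_mat TYPE('k) n n) f ?I)"
    then have rs: "r < n" "s < n"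
      using c by auto
    have "finsum (module_mat TYPE('k) n n) f ?I $$ (r, s) = (\<Sum>x\<in>?I. f x $$ (r, s))"
      by (rule finsum_mat_index[OF fc rs])
    also have "\<dots> = (\<Sum>x\<in>?I. if x = (r, s) then A $$ x else 0)"
      using rs by (intro sum.cong) (auto simp: f_def split: if_splits)
    also have "\<dots> = A $$ (r, s)"
      using rs by simp
    finally show "A $$ (r, s) = finsum (module_mat TYPE('k) n n) f ?I $$ (r, s)" ..
  qed (use A c in auto)
  then show ?thesis
    using N' by simp
qed

text \<open>The component of degree \<open>g\<close> of the grading in which the elementary matrix in position
  \<open>(i, j)\<close> has degree \<open>d i j\<close>.\<close>

definition supported_mats :: "nat \<Rightarrow> (nat \<Rightarrow> nat \<Rightarrow> 'g) \<Rightarrow> 'g \<Rightarrow> 'k::field mat set" where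
  "supported_mats n d g = {A \<in> carrier_mat n n. \<forall>i<n. \<forall>j<n. A $$ (i, j) \<noteq> 0 \<longrightarrow> d i j = g}"

lemma subspace_supported_mats:
  "VectorSpace.subspace class_ring (supported_mats n d g) (module_mat TYPE('k::field) n n)"
  by (rule subspace_matI) (auto simp: supported_mats_def, metis add.right_neutral)

lemma supported_mats_mult:
  fixes A B :: "'k::field mat"
  assumes d: "\<And>i j l. i < n \<Longrightarrow> j < n \<Longrightarrow> l < n \<Longrightarrow> d i j \<otimes>\<^bsub>G\<^esub> d j l = d i l"
    and A: "A \<in> supported_mats n d g" and B: "B \<in> supported_mats n d h"
  shows "A * B \<in> supported_mats n d (g \<otimes>\<^bsub>G\<^esub> h)"
proof -
  have c: "A \<in> carrier_mat n n" "B \<in> carrier_mat n n"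
    using A B by (auto simp: supported_mats_def)
  have "d i l = g \<otimes>\<^bsub>G\<^esub> h" if il: "i < n" "l < n" and "(A * B) $$ (i, l) \<noteq> 0" for i l
  proof -
    have "(\<Sum>j<n. A $$ (i, j) * B $$ (j, l)) \<noteq> 0"
      using that mat_mult_index[OF c il] by simp
    then obtain j where j: "j < n" "A $$ (i, j) * B $$ (j, l) \<noteq> 0"
      by (meson lessThan_iff sum.not_neutral_contains_not_neutral)
    then have "d i j = g" "d j l = h"
      using A B il by (auto simp: supported_mats_def)
    then show ?thesis
      using d[OF il(1) j(1) il(2)] by simp
  qed
  then show ?thesis
    using c by (auto simp: supported_mats_def)
qed

text \<open>The hypothesis on \<open>d\<close> is exactly what the relations between elementary matrices require.
  Both the free grading and the cyclic one arise in this way, and so does every copy of the cyclic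
  one along an isomorphism of groups.\<close>

lemma elementary_grading:
  assumes G: "group G" and dG: "\<And>i j. i < n \<Longrightarrow> j < n \<Longrightarrow> d i j \<in> carrier G"
    and d: "\<And>i j l. i < n \<Longrightarrow> j < n \<Longrightarrow> l < n \<Longrightarrow> d i j \<otimes>\<^bsub>G\<^esub> d j l = d i l"
  shows "is_grading class_ring (matrix_algebra TYPE('k::field) n) G (supported_mats n d)"
proof (rule is_grading_by_projections[where T = "(\<lambda>(i, j). d i j) ` ({..<n} \<times> {..<n})"
      and P = "\<lambda>g A. mat n n (\<lambda>(i, j). if d i j = g then A $$ (i, j) else 0)"])
  let ?P = "\<lambda>g (A :: 'k mat). mat n n (\<lambda>(i, j). if d i j = g then A $$ (i, j) else 0)"
  let ?T = "(\<lambda>(i, j). d i j) ` ({..<n} \<times> {..<n})"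
  show "?P s A = (if s = t then A else \<zero>\<^bsub>matrix_algebra TYPE('k) n\<^esub>)"
    if "s \<in> carrier G" "t \<in> carrier G" "A \<in> supported_mats n d t" for s t and A :: "'k mat"
  proof (rule eq_matI)
    fix i j assume "i < dim_row (if s = t then A else \<zero>\<^bsub>matrix_algebra TYPE('k) n\<^esub>)"
      "j < dim_col (if s = t then A else \<zero>\<^bsub>matrix_algebra TYPE('k) n\<^esub>)"
    then have "i < n" "j < n" "A $$ (i, j) \<noteq> 0 \<Longrightarrow> d i j = t"
      using that(3) by (auto simp: supported_mats_def module_mat_simps split: if_splits)
    then show "?P s A $$ (i, j) = (if s = t then A else \<zero>\<^bsub>matrix_algebra TYPE('k) n\<^esub>) $$ (i, j)"
      by (cases "A $$ (i, j) = 0") (auto simp: module_mat_simps)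
  qed (use that in \<open>auto simp: supported_mats_def module_mat_simps\<close>)
  show "?P s A = \<zero>\<^bsub>matrix_algebra TYPE('k) n\<^esub>"
    if "s \<in> carrier G - ?T" "A \<in> carrier (matrix_algebra TYPE('k) n)" for s A
    using that by (intro eq_matI) (auto simp: module_mat_simps)
  show "finsum (matrix_algebra TYPE('k) n) (\<lambda>s. ?P s A) ?T = A"
    if A: "A \<in> carrier (matrix_algebra TYPE('k) n)" for A
  proof -
    interpret abelian_group "matrix_algebra TYPE('k) n"
      by (rule abelian_group_mat)
    have c: "finsum (matrix_algebra TYPE('k) n) (\<lambda>s. ?P s A) ?T \<in> carrier_mat n n"
      using finsum_closed[of "\<lambda>s. ?P s A" ?T] by (simp add: module_mat_simps)
    show ?thesis
    proof (rule eq_matI)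
      fix i j assume "i < dim_row A" "j < dim_col A"
      then have ij: "i < n" "j < n"
        using A by (auto simp: module_mat_simps)
      have "finsum (matrix_algebra TYPE('k) n) (\<lambda>s. ?P s A) ?T $$ (i, j) = (\<Sum>s\<in>?T. ?P s A $$ (i, j))"
        using ij by (intro finsum_mat_index) auto
      also have "\<dots> = (\<Sum>s\<in>?T. if s = d i j then A $$ (i, j) else 0)"
        using ij by (intro sum.cong) auto
      also have "\<dots> = A $$ (i, j)"
        using ij by (subst sum.delta) auto
      finally show "finsum (matrix_algebra TYPE('k) n) (\<lambda>s. ?P s A) ?T $$ (i, j) = A $$ (i, j)" .
    qed (use A c in \<open>auto simp: module_mat_simps\<close>)
  qed
  show "A \<otimes>\<^bsub>matrix_algebra TYPE('k) n\<^esub> B \<in> supported_mats n d (s \<otimes>\<^bsub>G\<^esub> t)"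
    if "A \<in> supported_mats n d s" "B \<in> supported_mats n d t" for s t and A B :: "'k mat"
    using supported_mats_mult[OF d that] by (simp add: module_mat_simps)
  show "?P s (A \<oplus>\<^bsub>matrix_algebra TYPE('k) n\<^esub> B) = ?P s A \<oplus>\<^bsub>matrix_algebra TYPE('k) n\<^esub> ?P s B"
    if "A \<in> carrier (matrix_algebra TYPE('k) n)" "B \<in> carrier (matrix_algebra TYPE('k) n)" for s A B
    using that by (intro eq_matI) (auto simp: module_mat_simps)
qed (use G dG in \<open>auto simp: subspace_supported_mats, auto simp: supported_mats_def\<close>)

section \<open>The grading by the free group and the grading by diagonals\<close>

text \<open>The degree of the elementary matrix in the zero-based position \<open>(i, 0)\<close>. As
  \<open>s\<^sub>i \<dots> s\<^sub>1\<close> contains no inverse letter, it is already a reduced word.\<close>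

primrec path_word :: "nat \<Rightarrow> (nat \<times> bool) list" where
  "path_word 0 = []"
| "path_word (Suc i) = (Suc i, True) # path_word i"

lemma path_word_carrier: "{1..i} \<subseteq> S \<Longrightarrow> path_word i \<in> carrier (free_group S)"
proof (induction i)
  case (Suc i)
  moreover have "path_word i = [] \<or> snd (hd (path_word i))"
    by (cases i) auto
  ultimately show ?case
    by (fastforce simp: free_group_def reduced_word_Cons inverse_letters_def)
qed (simp add: free_group_def reduced_word_def)

lemma path_word_in_free_group: "i < n \<Longrightarrow> path_word i \<in> carrier (free_group {1..<n})"
  by (rule path_word_carrier) auto

lemma free_gen_carrier: "s \<in> S \<Longrightarrow> free_gen s \<in> carrier (free_group S)"
  by (auto simp: free_group_def free_gen_def reduced_word_def)

lemma free_gen_mult_path_word: "free_gen (Suc i) \<otimes>\<^bsub>free_group S\<^esub> path_word i = path_word (Suc i)"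
  by (cases i) (auto simp: free_group_def free_gen_def inverse_letters_def)

text \<open>The positions \<open>i\<close> and \<open>j\<close> are joined through position \<open>0\<close>: the elementary matrix in
  position \<open>(i, j)\<close> is the product of those in positions \<open>(i, 0)\<close> and
  \<open>(0, j)\<close>.\<close>

definition path_degree :: "nat set \<Rightarrow> nat \<Rightarrow> nat \<Rightarrow> (nat \<times> bool) list" where
  "path_degree S i j = path_word i \<otimes>\<^bsub>free_group S\<^esub> inv\<^bsub>free_group S\<^esub> path_word j"

lemma path_degree_carrier:
  assumes "path_word i \<in> carrier (free_group S)" "path_word j \<in> carrier (free_group S)"
  shows "path_degree S i j \<in> carrier (free_group S)"
proof -
  interpret group "free_group S"
    by (rule group_free_group)
  show ?thesis
    using assms by (simp add: path_degree_def)
qed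

lemma path_degree_mult:
  assumes "path_word i \<in> carrier (free_group S)" "path_word j \<in> carrier (free_group S)"
    "path_word l \<in> carrier (free_group S)"
  shows "path_degree S i j \<otimes>\<^bsub>free_group S\<^esub> path_degree S j l = path_degree S i l"
proof -
  interpret group "free_group S"
    by (rule group_free_group)
  have "inv\<^bsub>free_group S\<^esub> path_word j \<otimes>\<^bsub>free_group S\<^esub> (path_word j \<otimes>\<^bsub>free_group S\<^esub> x) = x"
    if "x \<in> carrier (free_group S)" for x
    using assms that by (simp flip: m_assoc)
  then show ?thesis
    using assms by (simp add: path_degree_def m_assoc)
qed

lemma path_degree_Suc:
  assumes i: "path_word i \<in> carrier (free_group S)" and S: "Suc i \<in> S"
  shows "path_degree S (Suc i) i = free_gen (Suc i)"
    "path_degree S i (Suc i) = inv\<^bsub>free_group S\<^esub> free_gen (Suc i)"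
proof -
  interpret group "free_group S"
    by (rule group_free_group)
  have *: "path_word (Suc i) = free_gen (Suc i) \<otimes>\<^bsub>free_group S\<^esub> path_word i"
    by (simp add: free_gen_mult_path_word)
  show "path_degree S (Suc i) i = free_gen (Suc i)"
    using i free_gen_carrier[OF S] by (simp add: path_degree_def * m_assoc del: path_word.simps)
  show "path_degree S i (Suc i) = inv\<^bsub>free_group S\<^esub> free_gen (Suc i)"
    using i free_gen_carrier[OF S]
    by (simp add: path_degree_def * inv_mult_group del: path_word.simps flip: m_assoc)
qed

lemma generate_free_group: "generate (free_group S) (free_gen ` S) = carrier (free_group S)"
proof
  interpret group "free_group S"
    by (rule group_free_group)
  show "generate (free_group S) (free_gen ` S) \<subseteq> carrier (free_group S)"
    by (intro generate_incl) (auto intro: free_gen_carrier)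
  show "carrier (free_group S) \<subseteq> generate (free_group S) (free_gen ` S)"
  proof
    fix w assume "w \<in> carrier (free_group S)"
    then show "w \<in> generate (free_group S) (free_gen ` S)"
    proof (induction w)
      case Nil
      then show ?case
        using generate.one[of "free_group S"] by (simp add: free_group_def)
    next
      case (Cons a w)
      obtain s b where a: "a = (s, b)"
        by (cases a)
      have s: "s \<in> S" and w: "w \<in> carrier (free_group S)"
        using Cons.prems by (auto simp: a free_group_def reduced_word_Cons)
      have "inv\<^bsub>free_group S\<^esub> [(s, True)] = [(s, False)]"
        using s by (intro inv_equality) (auto simp: free_group_def inverse_letters_def reduced_word_def)
      then have "[a] \<in> generate (free_group S) (free_gen ` S)"
        using s generate.incl[of "free_gen s" "free_gen ` S" "free_group S"]
          generate.inv[of "free_gen s" "free_gen ` S" "free_group S"]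
        by (cases b) (auto simp: a free_gen_def)
      then have "[a] \<otimes>\<^bsub>free_group S\<^esub> w \<in> generate (free_group S) (free_gen ` S)"
        using Cons.IH[OF w] by (rule generate.eng)
      also have "[a] \<otimes>\<^bsub>free_group S\<^esub> w = a # w"
        using Cons.prems by (cases w) (auto simp: free_group_def reduced_word_Cons)
      finally show ?case .
    qed
  qed
qed

definition exponent_sum :: "('s \<times> bool) list \<Rightarrow> int" where
  "exponent_sum w = (\<Sum>a\<leftarrow>w. if snd a then 1 else - 1)"

text \<open>Each cancellation removes a letter together with its inverse, so that reduction leaves the
  exponent sum unchanged. Modulo \<open>n\<close> this yields the homomorphism from the free group to
  \<open>C\<^sub>n\<close> that maps every free generator to the generator.\<close>

lemma exponent_sum_foldr_cons_reduce:
  "exponent_sum (foldr cons_reduce u v) = exponent_sum u + exponent_sum v"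
proof (induction u)
  case (Cons a u)
  have "exponent_sum (cons_reduce a w) = (if snd a then 1 else - 1) + exponent_sum w" for w
    by (cases w) (auto simp: exponent_sum_def inverse_letters_def)
  then show ?case
    using Cons by (simp add: exponent_sum_def)
qed (simp add: exponent_sum_def)

lemma exponent_sum_path_word [simp]: "exponent_sum (path_word i) = int i"
  by (induction i) (auto simp: exponent_sum_def)

definition cyclic_degree :: "nat \<Rightarrow> nat \<Rightarrow> nat \<Rightarrow> int" where
  "cyclic_degree n i j = (int i - int j) mod int n"

lemma exponent_sum_hom:
  assumes "0 < n"
  shows "(\<lambda>w. exponent_sum w mod int n) \<in> hom (free_group S) (cyc n)"
  using assms by (auto simp: hom_def carrier_integer_mod_group free_group_def
      exponent_sum_foldr_cons_reduce mod_simps)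

lemma exponent_sum_path_degree:
  assumes n: "0 < n" and i: "path_word i \<in> carrier (free_group S)" and j: "path_word j \<in> carrier (free_group S)"
  shows "exponent_sum (path_degree S i j) mod int n = cyclic_degree n i j"
proof -
  let ?F = "free_group S" and ?\<epsilon> = "\<lambda>w. exponent_sum w mod int n"
  interpret group_hom ?F "cyc n" ?\<epsilon>
    using exponent_sum_hom[OF n, of S]
    by (simp add: group_hom_def group_hom_axioms_def group_free_group)
  have "?\<epsilon> (path_degree S i j) = ?\<epsilon> (path_word i) \<otimes>\<^bsub>cyc n\<^esub> inv\<^bsub>cyc n\<^esub> ?\<epsilon> (path_word j)"
    using i j by (simp only: path_degree_def hom_mult hom_inv G.inv_closed)
  also have "\<dots> = cyclic_degree n i j"
    using n by (simp add: carrier_integer_mod_group cyclic_degree_def mod_simps)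
  finally show ?thesis .
qed

lemma cyclic_degree_carrier: "0 < n \<Longrightarrow> cyclic_degree n i j \<in> carrier (cyc n)"
  by (simp add: cyclic_degree_def carrier_integer_mod_group)

lemma cyclic_degree_mult: "cyclic_degree n i j \<otimes>\<^bsub>cyc n\<^esub> cyclic_degree n j l = cyclic_degree n i l"
  by (simp add: cyclic_degree_def mod_simps)

definition path_grading :: "nat \<Rightarrow> (nat \<times> bool) list \<Rightarrow> 'k::field mat set" where
  "path_grading n = supported_mats n (path_degree {1..<n})"

definition cyclic_grading :: "nat \<Rightarrow> int \<Rightarrow> 'k::field mat set" where
  "cyclic_grading n = supported_mats n (cyclic_degree n)"

lemma elem_mat_supported:
  "i < n \<Longrightarrow> j < n \<Longrightarrow> d i j = g \<Longrightarrow> elem_mat n (Suc i) (Suc j) \<in> supported_mats n d g"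
  by (auto simp: supported_mats_def)

lemma is_grading_path:
  "is_grading class_ring (matrix_algebra TYPE('k::field) n) (free_group {1..<n}) (path_grading n)"
  unfolding path_grading_def
  by (intro elementary_grading group_free_group path_degree_carrier path_degree_mult path_word_in_free_group)

lemma is_grading_cyclic:
  "0 < n \<Longrightarrow> is_grading class_ring (matrix_algebra TYPE('k::field) n) (cyc n) (cyclic_grading n)"
  unfolding cyclic_grading_def
  by (intro elementary_grading cyclic_degree_carrier cyclic_degree_mult) auto

lemma elem_mat_nonzero: "i < n \<Longrightarrow> j < n \<Longrightarrow> elem_mat n (Suc i) (Suc j) \<noteq> (0\<^sub>m n n :: 'k::field mat)"
  using elem_mat_index[of i n j "Suc i" "Suc j", where 'a='k] by (metis index_zero_mat(1) one_neq_zero)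

lemma is_grading_Y_path:
  assumes "0 < n"
  shows "is_grading_Y n (path_grading n :: _ \<Rightarrow> 'k::field mat set)"
proof -
  define F where "F = free_group {1..<n}"
  let ?Y = "path_grading n :: _ \<Rightarrow> 'k mat set" and ?A = "matrix_algebra TYPE('k) n"
  interpret group F
    unfolding F_def by (rule group_free_group)
  have w: "path_word i \<in> carrier F" if "i < n" for i
    unfolding F_def using that by (rule path_word_in_free_group)
  have E: "elem_mat n (Suc i) (Suc j) \<in> ?Y (path_degree {1..<n} i j)" if "i < n" "j < n" for i j
    using that by (simp add: path_grading_def elem_mat_supported)
  have step: "elem_mat n (Suc i) i \<in> ?Y (free_gen i) \<and> elem_mat n i (Suc i) \<in> ?Y (inv\<^bsub>F\<^esub> free_gen i) \<and>
      free_gen i \<in> support ?A F ?Y" if i: "i \<in> {1..<n}" for i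
  proof -
    obtain m where m: "i = Suc m" "Suc m < n"
      using i by (cases i) auto
    have "free_gen i \<in> carrier F"
      unfolding F_def using i by (rule free_gen_carrier)
    moreover have "elem_mat n (Suc i) i \<in> ?Y (free_gen i)" "elem_mat n i (Suc i) \<in> ?Y (inv\<^bsub>F\<^esub> free_gen i)"
      using E[of "Suc m" m] E[of m "Suc m"] path_degree_Suc[OF w[unfolded F_def], of m] m i
      by (simp_all add: F_def)
    moreover have "elem_mat n (Suc i) i \<noteq> (0\<^sub>m n n :: 'k mat)"
      using elem_mat_nonzero[of i n m, where 'k='k] m by simp
    ultimately show ?thesis
      by (auto simp: support_def module_mat_simps)
  qed
  then have "generate F (free_gen ` {1..<n}) \<subseteq> generate F (support ?A F ?Y)"
    by (intro mono_generate) auto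
  then have "carrier F \<subseteq> generate F (support ?A F ?Y)"
    unfolding F_def generate_free_group .
  moreover have "generate F (support ?A F ?Y) \<subseteq> carrier F"
    by (intro generate_incl) (auto simp: support_def)
  ultimately have "is_connected_grading class_ring ?A F ?Y"
    using is_grading_path[of n] by (simp add: is_connected_grading_def F_def)
  moreover have "\<exists>s\<in>carrier F. elem_mat n j i \<in> ?Y s" if ij: "i \<in> {1..n}" "j \<in> {1..n}" for i j
  proof -
    obtain i' j' where "i = Suc i'" "j = Suc j'" "i' < n" "j' < n"
      using ij by (cases i; cases j) auto
    then show ?thesis
      using E path_degree_carrier[OF w[unfolded F_def] w[unfolded F_def]] unfolding F_def by blast
  qed
  moreover have "elem_mat n i i \<in> ?Y \<one>\<^bsub>F\<^esub>" if i: "i \<in> {1..n}" for i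
  proof -
    obtain m where m: "i = Suc m" "m < n"
      using i by (cases i) auto
    then have "path_degree {1..<n} m m = \<one>\<^bsub>F\<^esub>"
      unfolding path_degree_def F_def[symmetric] using w by simp
    then show ?thesis
      using E[of m m] m by simp
  qed
  ultimately show ?thesis
    unfolding is_grading_Y_def Let_def F_def[symmetric] using step by blast
qed

text \<open>Only neighbouring elementary matrices have a prescribed degree; the degrees of all others follow by
  multiplying along the path between the two indices.\<close>

lemma elem_mat_path_degree:
  fixes Y :: "_ \<Rightarrow> 'k::field mat set"
  assumes Y: "is_grading_Y n Y" and ij: "i < n" "j < n"
  shows "elem_mat n (Suc i) (Suc j) \<in> Y (path_degree {1..<n} i j)"
proof -
  define F where "F = free_group {1..<n}"
  interpret group F
    unfolding F_def by (rule group_free_group)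
  have w: "path_word i \<in> carrier F" if "i < n" for i
    unfolding F_def using that by (rule path_word_in_free_group)
  have g: "free_gen i \<in> carrier F" if "i \<in> {1..<n}" for i
    unfolding F_def using that by (rule free_gen_carrier)
  have w_Suc: "path_word (Suc i) = free_gen (Suc i) \<otimes>\<^bsub>F\<^esub> path_word i" for i
    by (simp add: free_gen_mult_path_word F_def)
  have w_0: "path_word 0 = \<one>\<^bsub>F\<^esub>"
    by (simp add: free_group_def F_def)
  have gr: "is_grading class_ring (matrix_algebra TYPE('k) n) F Y"
    and one: "\<And>i. i \<in> {1..n} \<Longrightarrow> elem_mat n i i \<in> Y \<one>\<^bsub>F\<^esub>"
    and gen: "\<And>i. i \<in> {1..<n} \<Longrightarrow> elem_mat n (Suc i) i \<in> Y (free_gen i)"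
      "\<And>i. i \<in> {1..<n} \<Longrightarrow> elem_mat n i (Suc i) \<in> Y (inv\<^bsub>F\<^esub> free_gen i)"
    using Y unfolding is_grading_Y_def is_connected_grading_def Let_def F_def[symmetric] by blast+
  have mult: "elem_mat n (Suc i) (Suc l) \<in> Y (g \<otimes>\<^bsub>F\<^esub> h)"
    if "elem_mat n (Suc i) (Suc j) \<in> Y g" "elem_mat n (Suc j) (Suc l) \<in> Y h"
      "g \<in> carrier F" "h \<in> carrier F" "i < n" "j < n" "l < n" for i j l g h
    using is_gradingD(3)[OF gr that(3,4,1,2)] that(5-7) by (simp add: module_mat_simps elem_mat_mult)
  have left: "elem_mat n (Suc i) (Suc 0) \<in> Y (path_word i)" if "i < n" for i
    using that
  proof (induction i)
    case 0
    then show ?case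
      unfolding w_0 using one[of 1] by simp
  next
    case (Suc i)
    then show ?case
      unfolding w_Suc using mult[OF gen(1) Suc.IH] w g by simp
  qed
  have right: "elem_mat n (Suc 0) (Suc j) \<in> Y (inv\<^bsub>F\<^esub> path_word j)" if "j < n" for j
    using that
  proof (induction j)
    case 0
    then show ?case
      unfolding w_0 using one[of 1] by simp
  next
    case (Suc j)
    have "inv\<^bsub>F\<^esub> path_word (Suc j) = inv\<^bsub>F\<^esub> path_word j \<otimes>\<^bsub>F\<^esub> inv\<^bsub>F\<^esub> free_gen (Suc j)"
      unfolding w_Suc using Suc.prems w g by (simp add: inv_mult_group)
    then show ?case
      using mult[OF Suc.IH gen(2)] Suc.prems w g by simp
  qed
  show ?thesis
    unfolding path_degree_def F_def[symmetric] using mult[OF left right] ij w by simp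
qed

lemma is_grading_Y_unique:
  fixes Y :: "_ \<Rightarrow> 'k::field mat set"
  assumes Y: "is_grading_Y n Y" and s: "s \<in> carrier (free_group {1..<n})"
  shows "Y s = path_grading n s"
proof -
  have gr: "is_grading class_ring (matrix_algebra TYPE('k) n) (free_group {1..<n}) Y"
    using Y by (simp add: is_grading_Y_def is_connected_grading_def Let_def)
  show ?thesis
  proof (rule grading_le_imp_eq[OF is_grading_path gr _ s])
    fix t assume t: "t \<in> carrier (free_group {1..<n})"
    show "path_grading n t \<subseteq> Y t"
    proof
      fix A :: "'k mat" assume "A \<in> path_grading n t"
      then show "A \<in> Y t"
        using elem_mat_path_degree[OF Y]
        by (intro in_subspace_of_elem_mats[OF is_gradingD(2)[OF gr t], of A])
          (auto simp: path_grading_def supported_mats_def)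
    qed
  qed
qed

section \<open>Shift eigenspaces of the diagonals\<close>

text \<open>If the characteristic \<open>p\<close> divided \<open>n = p m\<close>, then
  \<open>0 = q\<^sup>n - 1 = (q\<^sup>m - 1)\<^sup>p\<close>, against the minimality of the order of
  \<open>q\<close>. The discrete Fourier transform below divides by \<open>n\<close>.\<close>

lemma of_nat_neq_0_of_primitive_root:
  fixes q :: "'k::field"
  assumes q: "primitive_root_of_unity n q"
  shows "of_nat n \<noteq> (0 :: 'k)"
proof
  assume "of_nat n = (0 :: 'k)"
  define p where "p = CHAR('k)"
  have n: "0 < n" "q ^ n = 1" and min: "\<And>m. 0 < m \<Longrightarrow> m < n \<Longrightarrow> q ^ m \<noteq> 1"
    using q by (auto simp: primitive_root_of_unity_def)
  have "p dvd n"
    using \<open>of_nat n = (0 :: 'k)\<close> by (simp add: of_nat_eq_0_iff_char_dvd p_def)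
  then obtain m where m: "n = p * m" ..
  have "0 < p"
    using n(1) m by (cases p) auto
  then have p: "prime p"
    unfolding p_def by (rule prime_CHAR_semidom)
  have "(q ^ m - 1) ^ p + 1 ^ p = (q ^ m - 1 + 1) ^ p"
    using freshmans_dream[of p "q ^ m - 1" 1] p by (simp add: p_def)
  also have "\<dots> = 1"
    using n(2) by (simp add: m mult.commute flip: power_mult)
  finally have "q ^ m = 1"
    by simp
  moreover have "0 < m" "m < n"
    using n(1) m prime_gt_1_nat[OF p] by auto
  ultimately show False
    using min by blast
qed

lemma primitive_root_power_inj:
  fixes q :: "'k::field"
  assumes q: "primitive_root_of_unity n q" and "q ^ a = q ^ b" "a < n" "b < n"
  shows "a = b"
proof -
  have "a = b" if "a \<le> b" "q ^ a = q ^ b" "b < n" for a b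
  proof (rule ccontr)
    assume "a \<noteq> b"
    have "q \<noteq> 0"
      using q by (auto simp: primitive_root_of_unity_def power_0_left)
    then have "q ^ (b - a) = 1"
      using that by (simp add: power_diff)
    then show False
      using q that \<open>a \<noteq> b\<close> by (auto simp: primitive_root_of_unity_def)
  qed
  then show ?thesis
    using assms(2-4) by (metis nat_le_linear)
qed

lemma primitive_root_power_mod:
  fixes q :: "'k::field"
  assumes q: "primitive_root_of_unity n q"
  shows "q ^ (k mod n) = q ^ k"
proof -
  have "q ^ k = q ^ (n * (k div n) + k mod n)"
    by simp
  also have "\<dots> = q ^ (k mod n)"
    using q by (simp only: power_add power_mult) (simp add: primitive_root_of_unity_def)
  finally show ?thesis ..
qed

lemma sum_powers_root_of_unity:
  fixes z :: "'k::field"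
  assumes "z ^ n = 1"
  shows "(\<Sum>m<n. z ^ m) = (if z = 1 then of_nat n else 0)"
  using power_diff_1_eq[of z n] assms by auto

lemma sum_periodic_shift:
  fixes g :: "nat \<Rightarrow> 'k::field"
  assumes "\<And>m. g (m + n) = g m"
  shows "(\<Sum>m<n. g (m + k)) = (\<Sum>m<n. g m)"
proof (induction k)
  case (Suc k)
  have "g k + (\<Sum>m<n. g (m + Suc k)) = (\<Sum>m<Suc n. g (m + k))"
    by (subst sum.lessThan_Suc_shift) simp
  also have "\<dots> = (\<Sum>m<n. g (m + k)) + g k"
    using assms[of k] by (simp add: add.commute)
  finally show ?case
    using Suc by simp
qed simp

text \<open>With \<open>x\<close> the shift matrix, the condition says \<open>x\<^sup>-\<^sup>1 A x = z A\<close>: conjugation by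
  \<open>x\<close> moves the entries of a matrix along its cyclic diagonals. The condition is stated for
  all powers of \<open>x\<close> at once, so that no iteration is needed later.\<close>

definition shift_eigen :: "nat \<Rightarrow> 'k::field \<Rightarrow> 'k mat \<Rightarrow> bool" where
  "shift_eigen n z A \<longleftrightarrow>
    (\<forall>i<n. \<forall>j<n. \<forall>m. A $$ ((i + m) mod n, (j + m) mod n) = z ^ m * A $$ (i, j))"

text \<open>The component of degree \<open>(s, t)\<close> is the line spanned by \<open>x\<^sup>s y\<^sup>t\<close>
  (see \<open>pauli_grading_scalar\<close>). Describing it as a simultaneous eigenspace, on the diagonal
  \<open>s\<close> and with eigenvalue \<open>q\<^sup>t\<close> of the shift, makes products and projections easy to
  compute.\<close>

definition pauli_grading :: "nat \<Rightarrow> 'k::field \<Rightarrow> int \<times> int \<Rightarrow> 'k mat set" where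
  "pauli_grading n q = (\<lambda>(s, t). {A \<in> cyclic_grading n s. shift_eigen n (q ^ nat t) A})"

text \<open>For an \<open>n\<close>-th root of unity \<open>z\<close>, the discrete Fourier projection onto the
  eigenvalue \<open>z\<close> of the shift.\<close>

definition shift_component :: "nat \<Rightarrow> 'k::field \<Rightarrow> 'k mat \<Rightarrow> 'k mat" where
  "shift_component n z A = mat n n (\<lambda>(i, j).
    (\<Sum>m<n. inverse z ^ m * A $$ ((i + m) mod n, (j + m) mod n)) / of_nat n)"

definition degree_component :: "nat \<Rightarrow> int \<Rightarrow> 'k::field mat \<Rightarrow> 'k mat" where
  "degree_component n s A = mat n n (\<lambda>(i, j). if cyclic_degree n i j = s then A $$ (i, j) else 0)"

lemma cyclic_degree_shift: "cyclic_degree n ((i + m) mod n) ((j + m) mod n) = cyclic_degree n i j"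
proof -
  have "int ((i + m) mod n) - int ((j + m) mod n) = (int i + int m) mod int n - (int j + int m) mod int n"
    by (simp add: zmod_int)
  then show ?thesis
    by (simp add: cyclic_degree_def mod_simps)
qed

lemma shift_eigen_mult:
  fixes A B :: "'k::field mat"
  assumes A: "A \<in> carrier_mat n n" "shift_eigen n z A" and B: "B \<in> carrier_mat n n" "shift_eigen n w B"
  shows "shift_eigen n (z * w) (A * B)"
  unfolding shift_eigen_def
proof (intro allI impI)
  fix i l m assume il: "i < n" "l < n"
  then have sh: "(i + m) mod n < n" "(l + m) mod n < n"
    by simp_all
  let ?g = "\<lambda>j. A $$ ((i + m) mod n, j mod n) * B $$ (j mod n, (l + m) mod n)"
  have "(A * B) $$ ((i + m) mod n, (l + m) mod n) = (\<Sum>j<n. ?g j)"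
    unfolding mat_mult_index[OF A(1) B(1) sh] by (intro sum.cong) auto
  also have "\<dots> = (\<Sum>j<n. ?g (j + m))"
    by (rule sum_periodic_shift[symmetric]) simp
  also have "\<dots> = (\<Sum>j<n. z ^ m * A $$ (i, j) * (w ^ m * B $$ (j, l)))"
    using A(2) B(2) il by (intro sum.cong) (auto simp: shift_eigen_def)
  also have "\<dots> = (z * w) ^ m * (A * B) $$ (i, l)"
    unfolding mat_mult_index[OF A(1) B(1) il] sum_distrib_left
    by (intro sum.cong) (auto simp: power_mult_distrib)
  finally show "(A * B) $$ ((i + m) mod n, (l + m) mod n) = (z * w) ^ m * (A * B) $$ (i, l)" .
qed

lemma shift_eigen_component:
  fixes A :: "'k::field mat"
  assumes "0 < n" and z: "z ^ n = 1"
  shows "shift_eigen n z (shift_component n z A)"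
  unfolding shift_eigen_def
proof (intro allI impI)
  fix i j k assume ij: "i < n" "j < n"
  have z0: "z \<noteq> 0"
    using z \<open>0 < n\<close> by (auto simp: power_0_left)
  let ?g = "\<lambda>m. inverse z ^ m * A $$ ((i + m) mod n, (j + m) mod n)"
  have "(\<Sum>m<n. inverse z ^ m * A $$ (((i + k) mod n + m) mod n, ((j + k) mod n + m) mod n))
      = (\<Sum>m<n. z ^ k * ?g (m + k))"
  proof (rule sum.cong)
    fix m
    have "((i + k) mod n + m) mod n = (i + (m + k)) mod n" "((j + k) mod n + m) mod n = (j + (m + k)) mod n"
      by (simp_all add: mod_simps ac_simps)
    moreover have "z ^ k * inverse z ^ (m + k) = inverse z ^ m"
      using z0 by (simp add: power_add power_inverse)
    ultimately show "inverse z ^ m * A $$ (((i + k) mod n + m) mod n, ((j + k) mod n + m) mod n) = z ^ k * ?g (m + k)"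
      by (simp flip: mult.assoc)
  qed simp
  also have "\<dots> = z ^ k * (\<Sum>m<n. ?g m)"
    using z by (subst sum_distrib_left[symmetric], subst sum_periodic_shift)
      (simp_all add: power_add power_inverse flip: add.assoc)
  finally show "shift_component n z A $$ ((i + k) mod n, (j + k) mod n) = z ^ k * shift_component n z A $$ (i, j)"
    using ij \<open>0 < n\<close> by (simp add: shift_component_def)
qed

lemma shift_component_eigen:
  fixes A :: "'k::field mat"
  assumes A: "A \<in> carrier_mat n n" "shift_eigen n w A" and z: "z ^ n = 1" and w: "w ^ n = 1"
    and n: "of_nat n \<noteq> (0 :: 'k)"
  shows "shift_component n z A = (if z = w then A else 0\<^sub>m n n)"
proof (rule eq_matI)
  fix i j
  assume "i < dim_row (if z = w then A else 0\<^sub>m n n)" "j < dim_col (if z = w then A else 0\<^sub>m n n)"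
  then have ij: "i < n" "j < n"
    using A by (auto split: if_splits)
  have "z \<noteq> 0"
    using z n by (cases n) auto
  then have zw: "inverse z * w = 1 \<longleftrightarrow> z = w"
    by (auto simp: field_simps)
  have "(\<Sum>m<n. inverse z ^ m * A $$ ((i + m) mod n, (j + m) mod n)) = (\<Sum>m<n. (inverse z * w) ^ m) * A $$ (i, j)"
    using A(2) ij unfolding sum_distrib_right
    by (intro sum.cong) (auto simp: shift_eigen_def power_mult_distrib)
  also have "(\<Sum>m<n. (inverse z * w) ^ m) = (if z = w then of_nat n else 0)"
    unfolding zw[symmetric] using z w
    by (intro sum_powers_root_of_unity) (simp add: power_mult_distrib power_inverse)
  finally show "shift_component n z A $$ (i, j) = (if z = w then A else 0\<^sub>m n n) $$ (i, j)"
    using ij n by (simp add: shift_component_def)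
qed (use A in \<open>auto simp: shift_component_def\<close>)

text \<open>Fourier inversion: after exchanging the two sums, the inner one runs over all powers of a root of
  unity and vanishes unless \<open>m = 0\<close>.\<close>

lemma sum_shift_components:
  fixes A :: "'k::field mat"
  assumes q: "primitive_root_of_unity n q" and ij: "i < n" "j < n"
  shows "(\<Sum>t<n. shift_component n (q ^ t) A $$ (i, j)) = A $$ (i, j)"
proof -
  have n: "of_nat n \<noteq> (0 :: 'k)"
    by (rule of_nat_neq_0_of_primitive_root[OF q])
  have qn: "q ^ n = 1"
    using q by (simp add: primitive_root_of_unity_def)
  have "(\<Sum>t<n. \<Sum>m<n. inverse (q ^ t) ^ m * A $$ ((i + m) mod n, (j + m) mod n))
      = (\<Sum>m<n. \<Sum>t<n. inverse (q ^ t) ^ m * A $$ ((i + m) mod n, (j + m) mod n))"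
    by (rule sum.swap)
  also have "\<dots> = (\<Sum>m<n. if m = 0 then of_nat n * A $$ ((i + m) mod n, (j + m) mod n) else 0)"
  proof (intro sum.cong refl)
    fix m assume m: "m \<in> {..<n}"
    have "inverse (q ^ t) ^ m = inverse (q ^ m) ^ t" for t
      by (simp add: power_inverse mult.commute flip: power_mult)
    then have "(\<Sum>t<n. inverse (q ^ t) ^ m) = (\<Sum>t<n. inverse (q ^ m) ^ t)"
      by simp
    also have "\<dots> = (if inverse (q ^ m) = 1 then of_nat n else 0)"
    proof (rule sum_powers_root_of_unity)
      have "(q ^ m) ^ n = (q ^ n) ^ m"
        by (simp add: mult.commute flip: power_mult)
      then show "inverse (q ^ m) ^ n = 1"
        by (simp add: power_inverse qn)
    qed
    also have "\<dots> = (if m = 0 then of_nat n else 0)"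
      using primitive_root_power_inj[OF q, of m 0] m by auto
    finally show "(\<Sum>t<n. inverse (q ^ t) ^ m * A $$ ((i + m) mod n, (j + m) mod n))
        = (if m = 0 then of_nat n * A $$ ((i + m) mod n, (j + m) mod n) else 0)"
      by (simp flip: sum_distrib_right)
  qed
  also have "\<dots> = of_nat n * A $$ (i, j)"
    using ij by simp
  finally show ?thesis
    using ij n by (simp add: shift_component_def flip: sum_divide_distrib)
qed

lemma subspace_pauli_grading:
  "VectorSpace.subspace class_ring (pauli_grading n q g) (module_mat TYPE('k::field) n n)"
proof (rule subspace_matI)
  obtain s t where g: "g = (s, t)"
    by (cases g)
  note sub = subspace_supported_mats[of n "cyclic_degree n" s, where 'k='k]
  show c: "pauli_grading n q g \<subseteq> carrier_mat n n"
    by (auto simp: pauli_grading_def cyclic_grading_def supported_mats_def g)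
  show "0\<^sub>m n n \<in> pauli_grading n q g"
    using subspaceD(3)[OF sub]
    by (auto simp: pauli_grading_def cyclic_grading_def module_mat_simps shift_eigen_def g)
  show "A + B \<in> pauli_grading n q g" if "A \<in> pauli_grading n q g" "B \<in> pauli_grading n q g" for A B
    using that c subspaceD(4)[OF sub, of A B]
    by (auto simp: pauli_grading_def cyclic_grading_def module_mat_simps shift_eigen_def g distrib_left)
  show "a \<cdot>\<^sub>m A \<in> pauli_grading n q g" if "A \<in> pauli_grading n q g" for a A
    using that c subspaceD(5)[OF sub, of a A]
    by (auto simp: pauli_grading_def cyclic_grading_def module_mat_simps class_ring_simps shift_eigen_def g)
qed

lemma is_grading_pauli:
  fixes q :: "'k::field"
  assumes q: "primitive_root_of_unity n q"
  shows "is_grading class_ring (matrix_algebra TYPE('k) n) (cyc n \<times>\<times> cyc n) (pauli_grading n q)"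
proof (rule is_grading_by_projections[where T = "carrier (cyc n \<times>\<times> cyc n)"
      and P = "\<lambda>(s, t) A. degree_component n s (shift_component n (q ^ nat t) A)"])
  let ?G = "cyc n \<times>\<times> cyc n" and ?A = "matrix_algebra TYPE('k) n"
  let ?P = "\<lambda>(s, t) A. degree_component n s (shift_component n (q ^ nat t) A)"
  have n: "0 < n" and qn: "q ^ n = 1" and n0: "of_nat n \<noteq> (0 :: 'k)"
    using q of_nat_neq_0_of_primitive_root[OF q] by (auto simp: primitive_root_of_unity_def)
  have roots: "(q ^ k) ^ n = 1" for k
    using qn by (metis power_mult mult.commute power_one)
  have G: "carrier ?G = {0..<int n} \<times> {0..<int n}"
    using n by (simp add: DirProd_def carrier_integer_mod_group)
  show "group ?G"
    by (simp add: DirProd_group)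
  show "VectorSpace.subspace class_ring (pauli_grading n q s) ?A" for s
    by (rule subspace_pauli_grading)
  show "finite (carrier ?G)" "carrier ?G \<subseteq> carrier ?G"
    unfolding G by simp_all
  show "A \<otimes>\<^bsub>?A\<^esub> B \<in> pauli_grading n q (g \<otimes>\<^bsub>?G\<^esub> h)"
    if gh: "g \<in> carrier ?G" "h \<in> carrier ?G" and AB: "A \<in> pauli_grading n q g" "B \<in> pauli_grading n q h" for g h A B
  proof -
    obtain s t s' t' where st: "g = (s, t)" "h = (s', t')"
      by (cases g; cases h)
    have A: "A \<in> cyclic_grading n s" "shift_eigen n (q ^ nat t) A"
      and B: "B \<in> cyclic_grading n s'" "shift_eigen n (q ^ nat t') B"
      using AB by (auto simp: st pauli_grading_def)
    have "nat ((t + t') mod int n) = (nat t + nat t') mod n"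
      using gh unfolding st G by (simp add: nat_mod_distrib nat_add_distrib)
    then have "q ^ nat t * q ^ nat t' = q ^ nat ((t + t') mod int n)"
      by (simp add: primitive_root_power_mod[OF q] power_add)
    moreover have "shift_eigen n (q ^ nat t * q ^ nat t') (A * B)"
      using A B by (intro shift_eigen_mult) (auto simp: cyclic_grading_def supported_mats_def)
    moreover have "A * B \<in> cyclic_grading n ((s + s') mod int n)"
      using is_gradingD(3)[OF is_grading_cyclic[OF n] _ _ A(1) B(1)] gh n
      by (simp add: st G carrier_integer_mod_group module_mat_simps)
    ultimately show ?thesis
      by (simp add: st pauli_grading_def module_mat_simps DirProd_def)
  qed
  show "?P g A \<in> pauli_grading n q g" if "g \<in> carrier ?G" for g A
  proof -
    obtain s t where st: "g = (s, t)"
      by (cases g)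
    have "shift_eigen n (q ^ nat t) (degree_component n s (shift_component n (q ^ nat t) A))"
      using shift_eigen_component[OF n roots, of "nat t" A] n
      by (simp add: shift_eigen_def degree_component_def cyclic_degree_shift)
    then show ?thesis
      by (auto simp: st pauli_grading_def cyclic_grading_def supported_mats_def degree_component_def)
  qed
  show "?P g (A \<oplus>\<^bsub>?A\<^esub> B) = ?P g A \<oplus>\<^bsub>?A\<^esub> ?P g B"
    if AB: "A \<in> carrier ?A" "B \<in> carrier ?A" for g A B
  proof -
    obtain s t where st: "g = (s, t)"
      by (cases g)
    show ?thesis
      using AB n by (intro eq_matI) (auto simp: st degree_component_def shift_component_def
          module_mat_simps distrib_left sum.distrib add_divide_distrib)
  qed
  show "?P g A = (if g = h then A else \<zero>\<^bsub>?A\<^esub>)"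
    if gh: "g \<in> carrier ?G" "h \<in> carrier ?G" and A: "A \<in> pauli_grading n q h" for g h A
  proof -
    obtain s t s' t' where st: "g = (s, t)" "h = (s', t')"
      by (cases g; cases h)
    have Ac: "A \<in> carrier_mat n n" and As: "shift_eigen n (q ^ nat t') A"
      and d: "\<And>i j. i < n \<Longrightarrow> j < n \<Longrightarrow> A $$ (i, j) \<noteq> 0 \<Longrightarrow> cyclic_degree n i j = s'"
      using A by (auto simp: st pauli_grading_def cyclic_grading_def supported_mats_def)
    have "q ^ nat t = q ^ nat t' \<longleftrightarrow> t = t'"
      using primitive_root_power_inj[OF q, of "nat t" "nat t'"] gh unfolding st G by (auto simp: nat_less_iff)
    then have "?P g A = degree_component n s (if t = t' then A else 0\<^sub>m n n)"
      using shift_component_eigen[OF Ac As roots roots n0] by (simp add: st)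
    also have "\<dots> = (if g = h then A else 0\<^sub>m n n)"
    proof (rule eq_matI)
      fix i j
      assume "i < dim_row (if g = h then A else 0\<^sub>m n n)" "j < dim_col (if g = h then A else 0\<^sub>m n n)"
      then have "i < n" "j < n"
        using Ac by (auto split: if_splits)
      then show "degree_component n s (if t = t' then A else 0\<^sub>m n n) $$ (i, j) = (if g = h then A else 0\<^sub>m n n) $$ (i, j)"
        using d[of i j] by (cases "A $$ (i, j) = 0") (auto simp: st degree_component_def)
    qed (use Ac in \<open>auto simp: degree_component_def\<close>)
    finally show ?thesis
      by (simp add: module_mat_simps)
  qed
  show "finsum ?A (\<lambda>g. ?P g A) (carrier ?G) = A" if A: "A \<in> carrier ?A" for A
  proof -
    interpret abelian_group ?A
      by (rule abelian_group_mat)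
    have Pc: "(\<lambda>g. ?P g A) \<in> carrier ?G \<rightarrow> carrier_mat n n"
      by (auto simp: degree_component_def)
    then have c: "finsum ?A (\<lambda>g. ?P g A) (carrier ?G) \<in> carrier_mat n n"
      using finsum_closed[of "\<lambda>g. ?P g A" "carrier ?G"] by (simp add: module_mat_simps)
    show ?thesis
    proof (rule eq_matI)
      fix i j assume "i < dim_row A" "j < dim_col A"
      then have ij: "i < n" "j < n"
        using A by (auto simp: module_mat_simps)
      have "finsum ?A (\<lambda>g. ?P g A) (carrier ?G) $$ (i, j) = (\<Sum>g\<in>carrier ?G. ?P g A $$ (i, j))"
        by (rule finsum_mat_index[OF Pc ij])
      also have "\<dots> = (\<Sum>s\<in>{0..<int n}. \<Sum>t\<in>{0..<int n}.
          if s = cyclic_degree n i j then shift_component n (q ^ nat t) A $$ (i, j) else 0)"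
        unfolding G sum.cartesian_product using ij
        by (intro sum.cong) (auto simp: degree_component_def)
      also have "\<dots> = (\<Sum>t\<in>{0..<int n}. \<Sum>s\<in>{0..<int n}.
          if s = cyclic_degree n i j then shift_component n (q ^ nat t) A $$ (i, j) else 0)"
        by (rule sum.swap)
      also have "\<dots> = (\<Sum>t\<in>{0..<int n}. shift_component n (q ^ nat t) A $$ (i, j))"
        using n by (simp add: cyclic_degree_def)
      also have "\<dots> = (\<Sum>t<n. shift_component n (q ^ t) A $$ (i, j))"
        by (rule sum.reindex_bij_witness[of _ int nat]) auto
      also have "\<dots> = A $$ (i, j)"
        by (rule sum_shift_components[OF q ij])
      finally show "finsum ?A (\<lambda>g. ?P g A) (carrier ?G) $$ (i, j) = A $$ (i, j)" .
    qed (use A c in \<open>auto simp: module_mat_simps\<close>)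
  qed
qed auto

section \<open>The products of shift and clock matrices\<close>

lemma cyclic_degree_eq_iff:
  assumes "i < n"
  shows "cyclic_degree n i j = int a mod int n \<longleftrightarrow> i = (j + a) mod n"
proof -
  have "cyclic_degree n i j = int a mod int n \<longleftrightarrow> int n dvd int i - (int j + int a)"
    by (simp add: cyclic_degree_def mod_eq_dvd_iff algebra_simps)
  also have "\<dots> \<longleftrightarrow> int (i mod n) = int ((j + a) mod n)"
    by (simp add: zmod_int mod_eq_dvd_iff)
  finally show ?thesis
    using assms by simp
qed

text \<open>The product \<open>x\<^sup>a y\<^sup>b\<close>, by its entries. In zero-based numbering column \<open>c\<close> belongs to
  the eigenvalue \<open>q\<^bsup>c+1\<^esup>\<close> of \<open>y\<close>.\<close>

definition shift_clock_mat :: "nat \<Rightarrow> 'k::field \<Rightarrow> nat \<Rightarrow> nat \<Rightarrow> 'k mat" where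
  "shift_clock_mat n q a b = mat n n (\<lambda>(r, c). if r = (c + a) mod n then q ^ (b * Suc c) else 0)"

lemma shift_clock_mat_simps [simp]:
  "shift_clock_mat n q a b \<in> carrier_mat n n"
  "dim_row (shift_clock_mat n q a b) = n" "dim_col (shift_clock_mat n q a b) = n"
  "i < n \<Longrightarrow> j < n \<Longrightarrow>
    shift_clock_mat n q a b $$ (i, j) = (if i = (j + a) mod n then q ^ (b * Suc j) else 0)"
  by (simp_all add: shift_clock_mat_def)

lemma shift_mat_conv: "shift_mat n = shift_clock_mat n q 1 0"
  by (rule eq_matI) (auto simp: shift_mat_def mod_Suc)

lemma clock_mat_conv: "clock_mat n q = shift_clock_mat n q 0 1"
  by (rule eq_matI) (auto simp: clock_mat_def)

lemma shift_mat_mult: "shift_mat n * shift_clock_mat n q a b = shift_clock_mat n q (Suc a) b"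
proof (rule eq_matI)
  fix i l assume "i < dim_row (shift_clock_mat n q (Suc a) b)" "l < dim_col (shift_clock_mat n q (Suc a) b)"
  then have il: "i < n" "l < n"
    by simp_all
  have "(shift_mat n * shift_clock_mat n q a b) $$ (i, l)
      = (\<Sum>j<n. shift_clock_mat n q 1 0 $$ (i, j) * shift_clock_mat n q a b $$ (j, l))"
    unfolding shift_mat_conv[of n q] by (rule mat_mult_index[OF _ _ il]) simp_all
  also have "\<dots> = (\<Sum>j<n. if j = (l + a) mod n then (if i = Suc j mod n then q ^ (b * Suc l) else 0) else 0)"
    using il by (intro sum.cong) auto
  also have "\<dots> = shift_clock_mat n q (Suc a) b $$ (i, l)"
    using il by (auto simp: mod_simps)
  finally show "(shift_mat n * shift_clock_mat n q a b) $$ (i, l) = shift_clock_mat n q (Suc a) b $$ (i, l)" .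
qed (simp_all add: shift_mat_def)

lemma mult_clock_mat: "shift_clock_mat n q a b * clock_mat n q = shift_clock_mat n q a (Suc b)"
proof (rule eq_matI)
  fix i l assume "i < dim_row (shift_clock_mat n q a (Suc b))" "l < dim_col (shift_clock_mat n q a (Suc b))"
  then have il: "i < n" "l < n"
    by simp_all
  have "(shift_clock_mat n q a b * clock_mat n q) $$ (i, l)
      = (\<Sum>j<n. shift_clock_mat n q a b $$ (i, j) * shift_clock_mat n q 0 1 $$ (j, l))"
    unfolding clock_mat_conv by (rule mat_mult_index[OF _ _ il]) simp_all
  also have "\<dots> = (\<Sum>j<n. if j = l then shift_clock_mat n q a b $$ (i, l) * q ^ Suc l else 0)"
    using il by (intro sum.cong) auto
  also have "\<dots> = shift_clock_mat n q a (Suc b) $$ (i, l)"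
    using il by (simp flip: power_Suc power_add) (simp add: algebra_simps)
  finally show "(shift_clock_mat n q a b * clock_mat n q) $$ (i, l) = shift_clock_mat n q a (Suc b) $$ (i, l)" .
qed (simp_all add: clock_mat_def)

lemma shift_clock_mat_in_pauli:
  assumes q: "primitive_root_of_unity n q"
  shows "shift_clock_mat n q a b \<in> pauli_grading n q (int a mod int n, int b mod int n)"
proof -
  let ?M = "shift_clock_mat n q a b"
  have n: "0 < n"
    using q by (simp add: primitive_root_of_unity_def)
  have "?M \<in> cyclic_grading n (int a mod int n)"
    by (simp add: cyclic_grading_def supported_mats_def cyclic_degree_eq_iff)
  moreover have "shift_eigen n (q ^ (b mod n)) ?M"
    unfolding shift_eigen_def
  proof (intro allI impI)
    fix i j m assume ij: "i < n" "j < n"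
    have "(i + m) mod n = ((j + m) mod n + a) mod n \<longleftrightarrow> i = (j + a) mod n"
      using n ij by (simp add: cyclic_degree_shift flip: cyclic_degree_eq_iff)
    moreover have "q ^ (b * Suc ((j + m) mod n)) = (q ^ (b mod n)) ^ m * q ^ (b * Suc j)"
    proof -
      \<comment> \<open>the exponent may wrap around because \<open>q\<^sup>n = 1\<close>\<close>
      have "q ^ (b * Suc ((j + m) mod n)) = q ^ b * (q ^ ((j + m) mod n)) ^ b"
        by (simp add: power_add power_mult mult.commute flip: power_mult)
      also have "\<dots> = q ^ b * (q ^ (j + m)) ^ b"
        by (simp add: primitive_root_power_mod[OF q])
      also have "\<dots> = q ^ (b * m) * q ^ (b * Suc j)"
        by (simp add: algebra_simps flip: power_mult power_add)
      also have "q ^ (b * m) = (q ^ (b mod n)) ^ m"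
        by (simp add: primitive_root_power_mod[OF q] power_mult)
      finally show ?thesis .
    qed
    ultimately show "?M $$ ((i + m) mod n, (j + m) mod n) = (q ^ (b mod n)) ^ m * ?M $$ (i, j)"
      using n ij by (simp del: mult_Suc_right)
  qed
  moreover have "nat (int b mod int n) = b mod n"
    by (simp flip: zmod_int)
  ultimately show ?thesis
    by (simp add: pauli_grading_def)
qed

text \<open>An eigenvector of the shift on a single diagonal is determined by one entry, and
  \<open>x\<^sup>a y\<^sup>b\<close> is such a vector without zeros on its diagonal.\<close>

lemma pauli_grading_scalar:
  fixes q :: "'k::field"
  assumes q: "primitive_root_of_unity n q" and A: "A \<in> pauli_grading n q (int a mod int n, int b mod int n)"
  obtains c where "A = c \<cdot>\<^sub>m shift_clock_mat n q a b"
proof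
  have n: "0 < n" and q0: "q \<noteq> 0"
    using q by (auto simp: primitive_root_of_unity_def power_0_left)
  have b: "nat (int b mod int n) = b mod n"
    by (simp flip: zmod_int)
  have Ac: "A \<in> carrier_mat n n"
    and zero: "\<And>i j. i < n \<Longrightarrow> j < n \<Longrightarrow> i \<noteq> (j + a) mod n \<Longrightarrow> A $$ (i, j) = 0"
    and eig: "\<And>i j m. i < n \<Longrightarrow> j < n \<Longrightarrow>
      A $$ ((i + m) mod n, (j + m) mod n) = (q ^ (b mod n)) ^ m * A $$ (i, j)"
    using A cyclic_degree_eq_iff[of _ n _ a]
    by (auto simp: pauli_grading_def cyclic_grading_def supported_mats_def shift_eigen_def b)
  show "A = (A $$ (a mod n, 0) / q ^ b) \<cdot>\<^sub>m shift_clock_mat n q a b"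
  proof (rule eq_matI)
    fix i j assume "i < dim_row ((A $$ (a mod n, 0) / q ^ b) \<cdot>\<^sub>m shift_clock_mat n q a b)"
      "j < dim_col ((A $$ (a mod n, 0) / q ^ b) \<cdot>\<^sub>m shift_clock_mat n q a b)"
    then have ij: "i < n" "j < n"
      by simp_all
    show "A $$ (i, j) = ((A $$ (a mod n, 0) / q ^ b) \<cdot>\<^sub>m shift_clock_mat n q a b) $$ (i, j)"
    proof (cases "i = (j + a) mod n")
      case True
      then have "A $$ (i, j) = A $$ ((a mod n + j) mod n, (0 + j) mod n)"
        using ij by (simp add: mod_simps add.commute)
      also have "\<dots> = (q ^ (b mod n)) ^ j * A $$ (a mod n, 0)"
        using n by (intro eig) auto
      finally show ?thesis
        using True ij q0 by (simp add: primitive_root_power_mod[OF q] power_add power_mult)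
    qed (use zero ij in simp)
  qed (use Ac in simp_all)
qed

lemma is_grading_X_pauli:
  fixes q :: "'k::field"
  assumes q: "primitive_root_of_unity n q"
  shows "is_grading_X n q (pauli_grading n q)"
proof -
  let ?G = "cyc n \<times>\<times> cyc n" and ?A = "matrix_algebra TYPE('k) n"
  have n: "0 < n" and q0: "q \<noteq> 0"
    using q by (auto simp: primitive_root_of_unity_def power_0_left)
  interpret group ?G
    by (simp add: DirProd_group)
  have "carrier ?G \<subseteq> support ?A ?G (pauli_grading n q)"
  proof
    fix g assume g: "g \<in> carrier ?G"
    obtain s t where st: "g = (s, t)"
      by (cases g)
    have "0 \<le> s" "s < int n" "0 \<le> t" "t < int n"
      using g n by (auto simp: st carrier_integer_mod_group)
    then have "shift_clock_mat n q (nat s) (nat t) \<in> pauli_grading n q g"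
      using shift_clock_mat_in_pauli[OF q, of "nat s" "nat t"] by (simp add: st)
    moreover have "shift_clock_mat n q (nat s) (nat t) $$ (nat s mod n, 0) \<noteq> 0"
      using n q0 by simp
    then have "shift_clock_mat n q (nat s) (nat t) \<noteq> 0\<^sub>m n n"
      using n by (metis index_zero_mat(1) mod_less_divisor)
    ultimately show "g \<in> support ?A ?G (pauli_grading n q)"
      using g by (auto simp: support_def module_mat_simps)
  qed
  moreover have "support ?A ?G (pauli_grading n q) \<subseteq> carrier ?G"
    by (auto simp: support_def)
  ultimately have "generate ?G (support ?A ?G (pauli_grading n q)) = carrier ?G"
    using generate_incl[of "carrier ?G"] generate.incl[of _ "carrier ?G" ?G] by auto
  then have "is_connected_grading class_ring ?A ?G (pauli_grading n q)"
    using is_grading_pauli[OF q] by (simp add: is_connected_grading_def)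
  moreover have "shift_mat n \<in> pauli_grading n q (cyc_gen n, \<one>\<^bsub>cyc n\<^esub>)"
    using shift_clock_mat_in_pauli[OF q, of 1 0] by (simp add: shift_mat_conv[of n q] cyc_gen_def)
  moreover have "clock_mat n q \<in> pauli_grading n q (\<one>\<^bsub>cyc n\<^esub>, cyc_gen n)"
    using shift_clock_mat_in_pauli[OF q, of 0 1] by (simp add: clock_mat_conv cyc_gen_def)
  ultimately show ?thesis
    by (simp add: is_grading_X_def)
qed

text \<open>The exponent of \<open>x\<close> is kept positive so that the induction starts from the generator
  \<open>x\<close>, whose degree is prescribed, and not from the unit matrix. Since
  \<open>x\<^sup>n = 1\<close>, every residue is still reached.\<close>

lemma shift_clock_mat_in_X:
  fixes q :: "'k::field"
  assumes n: "0 < n" and X: "is_grading_X n q X"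
  shows "shift_clock_mat n q (Suc a) b \<in> X (int (Suc a) mod int n, int b mod int n)"
proof (induction b)
  have gr: "is_grading class_ring (matrix_algebra TYPE('k) n) (cyc n \<times>\<times> cyc n) X"
    and x: "shift_mat n \<in> X (cyc_gen n, 0)" and y: "clock_mat n q \<in> X (0, cyc_gen n)"
    using X by (auto simp: is_grading_X_def is_connected_grading_def)
  have mult: "A * B \<in> X ((s + s') mod int n, (t + t') mod int n)"
    if "A \<in> X (s, t)" "B \<in> X (s', t')" "s \<in> {0..<int n}" "t \<in> {0..<int n}" "s' \<in> {0..<int n}" "t' \<in> {0..<int n}"
    for A B s t s' t'
    using is_gradingD(3)[OF gr _ _ that(1,2)] that(3-6) n
    by (simp add: carrier_integer_mod_group module_mat_simps)
  {
    case 0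
    show ?case
    proof (induction a)
      case 0
      then show ?case
        using x by (simp add: shift_mat_conv[of n q] cyc_gen_def)
    next
      case (Suc a)
      then show ?case
        using mult[OF x Suc] n by (simp add: shift_mat_mult cyc_gen_def mod_simps)
    qed
  next
    case (Suc b)
    then show ?case
      using mult[OF Suc y] n by (simp add: mult_clock_mat cyc_gen_def mod_simps add.commute)
  }
qed

lemma residue_as_Suc:
  assumes "0 < n" "s \<in> carrier (cyc n)"
  obtains a where "s = int (Suc a) mod int n"
proof
  \<comment> \<open>adding \<open>n\<close> keeps the residue and makes the representative positive\<close>
  show "s = int (Suc (nat s + (n - 1))) mod int n"
    using assms by (simp add: carrier_integer_mod_group)
qed

lemma residue_as_nat:
  assumes "0 < n" "s \<in> carrier (cyc n)"
  obtains a where "s = int a mod int n"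
  using residue_as_Suc[OF assms] .

lemma is_grading_X_unique:
  fixes q :: "'k::field"
  assumes q: "primitive_root_of_unity n q" and X: "is_grading_X n q X" and g: "g \<in> carrier (cyc n \<times>\<times> cyc n)"
  shows "X g = pauli_grading n q g"
proof -
  have n: "0 < n"
    using q by (simp add: primitive_root_of_unity_def)
  have gr: "is_grading class_ring (matrix_algebra TYPE('k) n) (cyc n \<times>\<times> cyc n) X"
    using X by (simp add: is_grading_X_def is_connected_grading_def)
  show ?thesis
  proof (rule grading_le_imp_eq[OF is_grading_pauli[OF q] gr _ g])
    fix h assume h: "h \<in> carrier (cyc n \<times>\<times> cyc n)"
    then have "fst h \<in> carrier (cyc n)" "snd h \<in> carrier (cyc n)"
      by auto
    then obtain a b where ab: "h = (int (Suc a) mod int n, int b mod int n)"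
      using residue_as_Suc[OF n] residue_as_nat[OF n] by (metis prod.collapse)
    show "pauli_grading n q h \<subseteq> X h"
    proof
      fix A assume "A \<in> pauli_grading n q h"
      then obtain c where "A = c \<cdot>\<^sub>m shift_clock_mat n q (Suc a) b"
        unfolding ab by (rule pauli_grading_scalar[OF q])
      then show "A \<in> X h"
        using subspaceD(5)[OF is_gradingD(2)[OF gr h], of c] shift_clock_mat_in_X[OF n X, of a b]
        by (simp add: ab class_ring_simps module_mat_simps)
    qed
  qed
qed

section \<open>The largest common quotient\<close>

lemma cyclic_quotient_of_X:
  fixes q :: "'k::field"
  assumes q: "primitive_root_of_unity n q" and X: "is_grading_X n q X"
  shows "has_quotient (matrix_algebra TYPE('k) n) (cyc n \<times>\<times> cyc n) X (cyc n) (cyclic_grading n)"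
proof (rule has_quotientI)
  show "is_grading class_ring (matrix_algebra TYPE('k) n) (cyc n \<times>\<times> cyc n) X"
    using X by (simp add: is_grading_X_def is_connected_grading_def)
  show "is_grading class_ring (matrix_algebra TYPE('k) n) (cyc n) (cyclic_grading n)"
    using q by (intro is_grading_cyclic) (simp add: primitive_root_of_unity_def)
  show "fst \<in> epi (cyc n \<times>\<times> cyc n) (cyc n)"
    by (force simp: epi_def hom_def DirProd_def intro: image_eqI[of _ _ "(_, 0)"])
  show "X g \<subseteq> cyclic_grading n (fst g)" if "g \<in> carrier (cyc n \<times>\<times> cyc n)" for g
    using is_grading_X_unique[OF q X that] by (auto simp: pauli_grading_def split: prod.splits)
qed

lemma cyclic_quotient_of_Y:
  fixes Y :: "_ \<Rightarrow> 'k::field mat set"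
  assumes n: "0 < n" and Y: "is_grading_Y n Y"
  shows "has_quotient (matrix_algebra TYPE('k) n) (free_group {1..<n}) Y (cyc n) (cyclic_grading n)"
proof (rule has_quotientI)
  let ?\<epsilon> = "\<lambda>w. exponent_sum w mod int n"
  show "is_grading class_ring (matrix_algebra TYPE('k) n) (free_group {1..<n}) Y"
    using Y by (simp add: is_grading_Y_def is_connected_grading_def Let_def)
  show "is_grading class_ring (matrix_algebra TYPE('k) n) (cyc n) (cyclic_grading n)"
    using n by (rule is_grading_cyclic)
  have "s \<in> ?\<epsilon> ` carrier (free_group {1..<n})" if s: "s \<in> carrier (cyc n)" for s
  proof -
    have "nat s < n" "0 \<le> s"
      using s n by (auto simp: carrier_integer_mod_group)
    then show ?thesis
      by (intro image_eqI[OF _ path_word_in_free_group]) auto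
  qed
  then show "?\<epsilon> \<in> epi (free_group {1..<n}) (cyc n)"
    using exponent_sum_hom[OF n, of "{1..<n}"] by (auto simp: epi_def hom_def)
  show "Y w \<subseteq> cyclic_grading n (?\<epsilon> w)" if w: "w \<in> carrier (free_group {1..<n})" for w
  proof
    fix A :: "'k mat" assume "A \<in> Y w"
    then have A: "A \<in> supported_mats n (path_degree {1..<n}) w"
      by (simp add: is_grading_Y_unique[OF Y w] path_grading_def)
    have "cyclic_degree n i j = ?\<epsilon> w" if ij: "i < n" "j < n" "A $$ (i, j) \<noteq> 0" for i j
    proof -
      have "path_degree {1..<n} i j = w"
        using A ij by (simp add: supported_mats_def)
      then show ?thesis
        using exponent_sum_path_degree[OF n path_word_in_free_group[OF ij(1)] path_word_in_free_group[OF ij(2)]]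
        by simp
    qed
    then show "A \<in> cyclic_grading n (?\<epsilon> w)"
      using A by (simp add: cyclic_grading_def supported_mats_def)
  qed
qed

lemma shift_clock_mat_mult_elem_mat:
  assumes "j < n" "i = (j + a) mod n"
  shows "shift_clock_mat n q a 0 * elem_mat n (Suc j) (Suc j) = elem_mat n (Suc i) (Suc j)"
proof (rule eq_matI)
  fix r c assume "r < dim_row (elem_mat n (Suc i) (Suc j))" "c < dim_col (elem_mat n (Suc i) (Suc j))"
  then have "r < n" "c < n"
    by simp_all
  then show "(shift_clock_mat n q a 0 * elem_mat n (Suc j) (Suc j)) $$ (r, c) = elem_mat n (Suc i) (Suc j) $$ (r, c)"
    using assms by (subst elem_mat_mult_right_index) auto
qed simp_all

text \<open>The heart of the argument. Let \<open>\<phi>\<close> and \<open>\<psi>\<close> be the epimorphisms that present \<open>V\<close>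
  as a quotient of \<open>X\<close> and of \<open>Y\<close>. The diagonal idempotents have degree \<open>1\<close> in
  \<open>Y\<close>, hence in \<open>V\<close>, and \<open>y\<close> is a combination of them. As \<open>y\<close> also has degree
  \<open>\<phi> (1, t)\<close> in \<open>V\<close>, this degree is trivial, and \<open>\<phi>\<close> factors through the first
  projection as an epimorphism \<open>\<theta>\<close>. Finally, each elementary matrix on the diagonal \<open>s\<close> is
  \<open>x\<^sup>s\<close> times a diagonal idempotent and so has degree \<open>\<theta> s\<close>.\<close>

lemma common_quotient_of_cyclic:
  fixes q :: "'k::field" and H :: "'h monoid"
  assumes q: "primitive_root_of_unity n q" and X: "is_grading_X n q X" and Y: "is_grading_Y n Y"
    and V: "common_quotient class_ring (matrix_algebra TYPE('k) n)
      (cyc n \<times>\<times> cyc n) X (free_group {1..<n}) Y H V"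
  shows "has_quotient (matrix_algebra TYPE('k) n) (cyc n) (cyclic_grading n) H V"
proof -
  let ?A = "matrix_algebra TYPE('k) n" and ?F = "free_group {1..<n}" and ?G = "cyc n \<times>\<times> cyc n"
  have n: "0 < n" and q0: "q \<noteq> 0"
    using q by (auto simp: primitive_root_of_unity_def power_0_left)
  have gX: "is_grading class_ring ?A ?G X" and gY: "is_grading class_ring ?A ?F Y"
    and gV: "is_grading class_ring ?A H V"
    using X Y V by (auto simp: is_grading_X_def is_grading_Y_def is_connected_grading_def Let_def common_quotient_def)
  obtain \<phi> where \<phi>: "\<phi> \<in> epi ?G H" and X_le: "\<forall>g\<in>carrier ?G. X g \<subseteq> V (\<phi> g)"
    using V unfolding common_quotient_def by (elim conjE, elim has_quotientE[OF gX])
  obtain \<psi> where \<psi>: "\<psi> \<in> epi ?F H" and Y_le: "\<forall>w\<in>carrier ?F. Y w \<subseteq> V (\<psi> w)"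
    using V unfolding common_quotient_def by (elim conjE, elim has_quotientE[OF gY])
  interpret \<psi>: group_hom ?F H \<psi>
    using \<psi> is_gradingD(1)[OF gV] by (simp add: group_hom_def group_hom_axioms_def group_free_group epi_def)
  interpret \<phi>: group_hom ?G H \<phi>
    using \<phi> is_gradingD(1)[OF gX] is_gradingD(1)[OF gV] by (simp add: group_hom_def group_hom_axioms_def epi_def)
  have diag: "elem_mat n (Suc i) (Suc i) \<in> V \<one>\<^bsub>H\<^esub>" if "i < n" for i
  proof -
    have "elem_mat n (Suc i) (Suc i) \<in> Y \<one>\<^bsub>?F\<^esub>"
      using Y that by (simp add: is_grading_Y_def Let_def)
    then show ?thesis
      using Y_le \<psi>.hom_one \<psi>.G.one_closed by fastforce
  qed
  have gen: "(0, cyc_gen n) \<in> carrier ?G"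
    using n by (simp add: cyc_gen_def carrier_integer_mod_group)
  have y1: "clock_mat n q \<in> V \<one>\<^bsub>H\<^esub>"
    using diag by (intro in_subspace_of_elem_mats[OF is_gradingD(2)[OF gV \<psi>.H.one_closed], of "clock_mat n q"])
      (auto simp: clock_mat_def split: if_splits)
  have y2: "clock_mat n q \<in> V (\<phi> (0, cyc_gen n))"
    using X subsetD[OF bspec[OF X_le gen]] by (simp add: is_grading_X_def)
  have "clock_mat n q $$ (0, 0) \<noteq> 0"
    using n q0 by (simp add: clock_mat_def)
  then have "clock_mat n q \<noteq> \<zero>\<^bsub>?A\<^esub>"
    using n by (auto simp: module_mat_simps)
  then have \<phi>_gen: "\<phi> (0, cyc_gen n) = \<one>\<^bsub>H\<^esub>"
    using grading_components_disjoint[OF gV _ y2 _ y1] gen by simp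
  have \<phi>_snd: "\<phi> (0, int b mod int n) = \<one>\<^bsub>H\<^esub>" for b
  proof (induction b)
    case 0
    show ?case
      using \<phi>.hom_one by (simp add: DirProd_def)
  next
    case (Suc b)
    have b: "(0, int b mod int n) \<in> carrier ?G"
      using n by (simp add: carrier_integer_mod_group)
    have "(0, int (Suc b) mod int n) = (0, cyc_gen n) \<otimes>\<^bsub>?G\<^esub> (0, int b mod int n)"
      by (simp add: cyc_gen_def mod_simps)
    then show ?case
      using \<phi>.hom_mult[OF gen b] \<phi>_gen Suc by simp
  qed
  define \<theta> where "\<theta> s = \<phi> (s, 0)" for s
  have \<theta>c: "(s, 0) \<in> carrier ?G" if "s \<in> carrier (cyc n)" for s
    using that by simp
  have "\<theta> \<in> hom (cyc n) H"
  proof (rule homI)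
    fix s s' assume s: "s \<in> carrier (cyc n)" "s' \<in> carrier (cyc n)"
    show "\<theta> s \<in> carrier H"
      using s \<theta>c by (simp add: \<theta>_def)
    show "\<theta> (s \<otimes>\<^bsub>cyc n\<^esub> s') = \<theta> s \<otimes>\<^bsub>H\<^esub> \<theta> s'"
      using \<phi>.hom_mult[OF \<theta>c \<theta>c, OF s] by (simp add: \<theta>_def)
  qed
  moreover have "h \<in> \<theta> ` carrier (cyc n)" if "h \<in> carrier H" for h
  proof -
    obtain g where "g \<in> carrier ?G" "h = \<phi> g"
      using \<phi> \<open>h \<in> carrier H\<close> unfolding epi_def by blast
    then obtain s t where st: "s \<in> carrier (cyc n)" "t \<in> carrier (cyc n)" "h = \<phi> (s, t)"
      by (cases g) auto
    obtain b where b: "t = int b mod int n"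
      by (rule residue_as_nat[OF n st(2)])
    have "(s, t) = (s, 0) \<otimes>\<^bsub>?G\<^esub> (0, t)"
      using st n by (simp add: carrier_integer_mod_group)
    moreover have "(0, t) \<in> carrier ?G"
      using st by simp
    ultimately have "h = \<theta> s"
      using \<phi>.hom_mult[OF \<theta>c[OF st(1)], of "(0, t)"] \<phi>_snd[of b] st \<theta>c[OF st(1)] by (simp add: \<theta>_def b)
    then show ?thesis
      using st by blast
  qed
  ultimately have \<theta>: "\<theta> \<in> epi (cyc n) H"
    by (auto simp: epi_def hom_def)
  show ?thesis
  proof (rule has_quotientI[OF is_grading_cyclic[OF n] gV \<theta>])
    fix s assume s: "s \<in> carrier (cyc n)"
    obtain a where a: "s = int (Suc a) mod int n"
      by (rule residue_as_Suc[OF n s])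
    have \<theta>s: "\<theta> s \<in> carrier H"
      using \<theta>c[OF s] by (simp add: \<theta>_def)
    have M: "shift_clock_mat n q (Suc a) 0 \<in> V (\<theta> s)"
      using shift_clock_mat_in_X[OF n X, of a 0] subsetD[OF bspec[OF X_le \<theta>c[OF s]]]
      by (simp add: \<theta>_def a)
    show "cyclic_grading n s \<subseteq> V (\<theta> s)"
    proof
      fix A :: "'k mat" assume A: "A \<in> cyclic_grading n s"
      show "A \<in> V (\<theta> s)"
      proof (rule in_subspace_of_elem_mats[OF is_gradingD(2)[OF gV \<theta>s]])
        show "A \<in> carrier_mat n n"
          using A by (simp add: cyclic_grading_def supported_mats_def)
        fix i j assume ij: "i < n" "j < n" "A $$ (i, j) \<noteq> 0"
        then have "i = (j + Suc a) mod n"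
          using A cyclic_degree_eq_iff[of i n j "Suc a"] by (auto simp: cyclic_grading_def supported_mats_def a)
        then have "elem_mat n (Suc i) (Suc j) = shift_clock_mat n q (Suc a) 0 * elem_mat n (Suc j) (Suc j)"
          using ij shift_clock_mat_mult_elem_mat by metis
        also have "\<dots> \<in> V (\<theta> s \<otimes>\<^bsub>H\<^esub> \<one>\<^bsub>H\<^esub>)"
          using is_gradingD(3)[OF gV \<theta>s _ M diag[OF ij(2)]] by (simp add: module_mat_simps)
        finally show "elem_mat n (Suc i) (Suc j) \<in> V (\<theta> s)"
          using \<theta>s by simp
      qed
    qed
  qed
qed

text \<open>Maximality quantifies only over competitors whose group elements are cosets. To compare the
  cyclic grading with an arbitrary maximal common quotient, it must first be carried over to a group of
  cosets isomorphic to \<open>C\<^sub>n\<close>.\<close>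

lemma cyclic_grading_relabel:
  fixes H :: "'h monoid"
  assumes n: "0 < n" and H: "group H" and \<kappa>: "\<kappa> \<in> iso (cyc n) H"
  obtains W :: "'h \<Rightarrow> 'k::field mat set"
  where "is_grading class_ring (matrix_algebra TYPE('k) n) H W"
    "same_grading (cyc n) (cyclic_grading n) H W"
proof
  let ?W = "supported_mats n (\<lambda>i j. \<kappa> (cyclic_degree n i j)) :: 'h \<Rightarrow> 'k mat set"
  interpret group_hom "cyc n" H \<kappa>
    using H \<kappa> by (simp add: group_hom_def group_hom_axioms_def iso_def)
  show "is_grading class_ring (matrix_algebra TYPE('k) n) H ?W"
    using cyclic_degree_carrier[OF n] hom_mult[symmetric] cyclic_degree_mult
    by (intro elementary_grading H) auto
  \<comment> \<open>equality of degrees may be tested after applying \<open>\<kappa>\<close>\<close>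
  have "inj_on \<kappa> (carrier (cyc n))"
    using \<kappa> by (simp add: iso_def bij_betw_def)
  then have "?W (\<kappa> s) = cyclic_grading n s" if "s \<in> carrier (cyc n)" for s
    using that cyclic_degree_carrier[OF n] by (simp add: supported_mats_def cyclic_grading_def inj_on_eq_iff)
  then show "same_grading (cyc n) (cyclic_grading n) H ?W"
    using \<kappa> by (auto simp: same_grading_def)
qed

theorem proposition4p15:
  fixes n :: nat and q :: "'k::field"
  assumes "primitive_root_of_unity n q"
  shows "(\<exists>X. is_grading_X n q X) \<and>
    (\<exists>Y :: (nat \<times> bool) list \<Rightarrow> 'k mat set. is_grading_Y n Y) \<and>
    (\<forall>X (Y :: (nat \<times> bool) list \<Rightarrow> 'k mat set).
       is_grading_X n q X \<longrightarrow> is_grading_Y n Y \<longrightarrow>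
       (\<exists>W.
          maximal_common_quotient class_ring (matrix_algebra TYPE('k) n)
            (cyc n \<times>\<times> cyc n) X (free_group {1..<n}) Y (cyc n) W \<and>
          (\<forall>(H :: 'h monoid) V.
             maximal_common_quotient class_ring (matrix_algebra TYPE('k) n)
               (cyc n \<times>\<times> cyc n) X (free_group {1..<n}) Y H V
             \<longrightarrow> same_grading H V (cyc n) W)))"
proof (intro conjI allI impI)
  have n: "0 < n"
    using assms by (simp add: primitive_root_of_unity_def)
  show "\<exists>X. is_grading_X n q X"
    using is_grading_X_pauli[OF assms] by blast
  show "\<exists>Y :: (nat \<times> bool) list \<Rightarrow> 'k mat set. is_grading_Y n Y"
    using is_grading_Y_path[OF n] by blast
  fix X :: "int \<times> int \<Rightarrow> 'k mat set" and Y :: "(nat \<times> bool) list \<Rightarrow> 'k mat set"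
  assume X: "is_grading_X n q X" and Y: "is_grading_Y n Y"
  let ?A = "matrix_algebra TYPE('k) n" and ?G = "cyc n \<times>\<times> cyc n" and ?F = "free_group {1..<n}"
  let ?C = "cyc n" and ?W = "cyclic_grading n :: int \<Rightarrow> 'k mat set"
  have gX: "is_grading class_ring ?A ?G X" and gY: "is_grading class_ring ?A ?F Y"
    using X Y by (auto simp: is_grading_X_def is_grading_Y_def is_connected_grading_def Let_def)
  have gW: "is_grading class_ring ?A ?C ?W"
    using n by (rule is_grading_cyclic)
  have XW: "has_quotient ?A ?G X ?C ?W"
    by (rule cyclic_quotient_of_X[OF assms X])
  have YW: "has_quotient ?A ?F Y ?C ?W"
    by (rule cyclic_quotient_of_Y[OF n Y])
  have fin: "finite (carrier ?C)"
    using n by (simp add: carrier_integer_mod_group)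
  have "same_grading H' W' ?C ?W"
    if H': "common_quotient class_ring ?A ?G X ?F Y H' W'" and Q: "has_quotient ?A H' W' ?C ?W"
    for H' :: "(int \<times> int) set monoid" and W'
  proof -
    have "is_grading class_ring ?A H' W'"
      using H' by (simp add: common_quotient_def)
    then have "same_grading ?C ?W H' W'"
      using mutual_quotients_same[OF gW _ fin common_quotient_of_cyclic[OF assms X Y H'] Q] by blast
    then show ?thesis
      by (rule same_grading_sym[OF is_gradingD(1)[OF gW]])
  qed
  then have max: "maximal_common_quotient class_ring ?A ?G X ?F Y ?C ?W"
    unfolding maximal_common_quotient_def common_quotient_def[of _ _ _ _ _ _ ?C] using gW XW YW by blast
  have uniq: "same_grading H V ?C ?W"
    if HV: "maximal_common_quotient class_ring ?A ?G X ?F Y H V" for H :: "'h monoid" and V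
  proof -
    have cHV: "common_quotient class_ring ?A ?G X ?F Y H V"
      using HV by (simp add: maximal_common_quotient_def)
    then have gV: "is_grading class_ring ?A H V"
      by (simp add: common_quotient_def)
    \<comment> \<open>the cosets of \<open>N\<close> form a copy of \<open>C\<^sub>n\<close>, which serves as the competitor\<close>
    obtain N where N: "N \<lhd> ?G" and "same_grading (?G Mod N) (quotient_grading ?A X) ?C ?W"
      using XW by (auto simp: has_quotient_def)
    then have "same_grading ?C ?W (?G Mod N) (quotient_grading ?A X)"
      using normal.factorgroup_is_group same_grading_sym by blast
    then obtain \<kappa> where "\<kappa> \<in> iso ?C (?G Mod N)"
      by (auto simp: same_grading_def)
    then obtain W' :: "(int \<times> int) set \<Rightarrow> 'k mat set"
      where gW': "is_grading class_ring ?A (?G Mod N) W'" and WW': "same_grading ?C ?W (?G Mod N) W'"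
      by (rule cyclic_grading_relabel[OF n normal.factorgroup_is_group[OF N]])
    have W'W: "same_grading (?G Mod N) W' ?C ?W"
      by (rule same_grading_sym[OF is_gradingD(1)[OF gW] WW'])
    note Q = same_grading_imp_has_quotient[OF gW gW' WW']
    have "common_quotient class_ring ?A ?G X ?F Y (?G Mod N) W'"
      unfolding common_quotient_def
      using gW' has_quotient_trans[OF gX gW gW' XW Q] has_quotient_trans[OF gY gW gW' YW Q] by blast
    moreover have "has_quotient ?A (?G Mod N) W' H V"
      using has_quotient_trans[OF gW' gW gV same_grading_imp_has_quotient[OF gW' gW W'W]
          common_quotient_of_cyclic[OF assms X Y cHV]] .
    ultimately have "same_grading (?G Mod N) W' H V"
      using HV unfolding maximal_common_quotient_def by blast
    then have "same_grading ?C ?W H V"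
      by (rule same_grading_trans[OF WW'])
    then show ?thesis
      by (rule same_grading_sym[OF is_gradingD(1)[OF gW]])
  qed
  show "\<exists>W. maximal_common_quotient class_ring ?A ?G X ?F Y ?C W \<and>
      (\<forall>(H :: 'h monoid) V. maximal_common_quotient class_ring ?A ?G X ?F Y H V \<longrightarrow> same_grading H V ?C W)"
    using max uniq by blast
qed

end
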